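(* Let $1<p<\infty$, let $f\in\sigma_p$, and let $g=f\,r_c^{\alpha}$ with $c\in\mathbb R$ and $0<\alpha<1$. Then $D(T_g)=D(T_f)$ and $$\ker T_g=\left(\frac{\xi+i}{\xi-c}\right)^{\alpha}\ker T_f\,\cap\, D(T_g).$$
   Context: $L_p=L^p(\mathbb R)$; $H_p^+=H^p(\mathbb C^+)$ and $H_p^-=\overline{H_p^+}=H^p(\mathbb C^-)$, identified with closed subspaces of $L_p$ via boundary values. $\sigma_p$ is the class of measurable functions $g$ on $\mathbb R$ for which there exists $\phi\in H_p^+\setminus\{0\}$ with $g\phi\in L_p$. For $g\in\sigma_p$ the (possibly unbounded) Toeplitz operator $T_g$ has domain $D(T_g)=\{\phi_+\in H_p^+: g\phi_+\in L_p\}$ and $T_g\phi_+=P^+(g\phi_+)$, with $P^+$ the projection of $L_p$ onto $H_p^+$ parallel to $H_p^-$; thus $\ker T_g=\{\phi_+\in H_p^+: g\phi_+\in H_p^-\}$. For $c\in\mathbb R$ and $\alpha\in\mathbb C\setminus\mathbb Z$, $z_c^\alpha=e^{\alpha\log z}$, where the branch cut of $\log$ connects $0$ to $\infty$ and intersects the unit circle (only) at $z_0=\frac{c-i}{c+i}$, and $\log 1=0$; and $r_c^\alpha(\xi)=\left(\frac{\xi-i}{\xi+i}\right)_c^\alpha$ for $\xi\in\mathbb R$, which is continuous on $\mathbb R\cup\{\infty\}$ except at $c$, where it has different finite one-sided limits. The function $\left(\frac{\xi+i}{\xi-c}\right)^\alpha$ is a branch analytic in $\mathbb C^+$ (the choice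 of branch only changes it by a constant factor). The notation $F\ker T_f\cap D(T_g)$ means $\{F\psi:\psi\in\ker T_f\}\cap D(T_g)$. *)

theory Defs
  imports "HOL-Analysis.Analysis"
begin

text \<open>
  Elements of \<open>L\<^sub>p\<close> are represented by Lebesgue measurable functions \<open>real \<Rightarrow> complex\<close>. All the sets
  of functions below (\<open>Lp\<close>, \<open>Hp_plus\<close>, \<open>Hp_minus\<close>, domains, kernels and \<open>times_set\<close>) are unions of
  classes modulo almost everywhere equality, so that equality of such sets of functions is equality
  of the corresponding subsets of \<open>L\<^sub>p\<close>.
\<close>

definition Lp :: "real \<Rightarrow> (real \<Rightarrow> complex) set" where
  "Lp p = {f \<in> borel_measurable lebesgue. integrable lebesgue (\<lambda>x. norm (f x) powr p)}"

definition upper_halfplane :: "complex set" where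
  "upper_halfplane = {z. 0 < Im z}"

definition hardy_space :: "real \<Rightarrow> (complex \<Rightarrow> complex) set" where
  "hardy_space p = {F. F holomorphic_on upper_halfplane \<and>
     (SUP y\<in>{0<..}. \<integral>\<^sup>+ x. ennreal (norm (F (Complex x y)) powr p) \<partial>lebesgue) < \<infinity>}"

text \<open>Boundary values are nontangential limits, taken in all Stolz angles, almost everywhere.\<close>

definition stolz_angle :: "real \<Rightarrow> real \<Rightarrow> complex set" where
  "stolz_angle a x = {z. 0 < Im z \<and> \<bar>Re z - x\<bar> < a * Im z}"

definition has_boundary_values :: "(complex \<Rightarrow> complex) \<Rightarrow> (real \<Rightarrow> complex) \<Rightarrow> bool" where
  "has_boundary_values F f \<longleftrightarrow>
     (AE x in lebesgue. \<forall>a>0. (F \<longlongrightarrow> f x) (at (complex_of_real x) within stolz_angle a x))"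

definition Hp_plus :: "real \<Rightarrow> (real \<Rightarrow> complex) set" where
  "Hp_plus p = {f \<in> Lp p. \<exists>F \<in> hardy_space p. has_boundary_values F f}"

definition Hp_minus :: "real \<Rightarrow> (real \<Rightarrow> complex) set" where
  "Hp_minus p = {\<lambda>x. cnj (f x) | f. f \<in> Hp_plus p}"

text \<open>
  The projection of \<open>L\<^sub>p\<close> onto \<open>H\<^sub>p\<^sup>+\<close> parallel to \<open>H\<^sub>p\<^sup>-\<close>, given by its graph: \<open>P_plus p h u\<close> means
  \<open>P\<^sup>+ h = u\<close> in \<open>L\<^sub>p\<close>. For \<open>1 < p < \<infinity>\<close> the space \<open>L\<^sub>p\<close> is the direct sum of \<open>H\<^sub>p\<^sup>+\<close> and \<open>H\<^sub>p\<^sup>-\<close>, so \<open>u\<close>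
  exists and is unique up to almost everywhere equality.
\<close>

definition P_plus :: "real \<Rightarrow> (real \<Rightarrow> complex) \<Rightarrow> (real \<Rightarrow> complex) \<Rightarrow> bool" where
  "P_plus p h u \<longleftrightarrow> h \<in> Lp p \<and> u \<in> Hp_plus p \<and> (\<lambda>x. h x - u x) \<in> Hp_minus p"

definition symbol_class :: "real \<Rightarrow> (real \<Rightarrow> complex) set" where
  "symbol_class p = {g \<in> borel_measurable lebesgue.
     \<exists>\<phi> \<in> Hp_plus p. \<not> (AE x in lebesgue. \<phi> x = 0) \<and> (\<lambda>x. g x * \<phi> x) \<in> Lp p}"

definition toeplitz_domain :: "real \<Rightarrow> (real \<Rightarrow> complex) \<Rightarrow> (real \<Rightarrow> complex) set" where
  "toeplitz_domain p g = {\<phi> \<in> Hp_plus p. (\<lambda>x. g x * \<phi> x) \<in> Lp p}"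

text \<open>The graph of \<open>T\<^sub>g\<close>: \<open>toeplitz p g \<phi> u\<close> means \<open>\<phi> \<in> D(T\<^sub>g)\<close> and \<open>T\<^sub>g \<phi> = u\<close>.\<close>

definition toeplitz :: "real \<Rightarrow> (real \<Rightarrow> complex) \<Rightarrow> (real \<Rightarrow> complex) \<Rightarrow> (real \<Rightarrow> complex) \<Rightarrow> bool" where
  "toeplitz p g \<phi> u \<longleftrightarrow> \<phi> \<in> toeplitz_domain p g \<and> P_plus p (\<lambda>x. g x * \<phi> x) u"

definition toeplitz_kernel :: "real \<Rightarrow> (real \<Rightarrow> complex) \<Rightarrow> (real \<Rightarrow> complex) set" where
  "toeplitz_kernel p g = {\<phi>. toeplitz p g \<phi> (\<lambda>x. 0)}"

text \<open>
  The set \<open>F K\<close> of all products \<open>F \<psi>\<close> with \<open>\<psi> \<in> K\<close>. The almost everywhere equality makes the value of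
  \<open>F\<close> at its singularities irrelevant.
\<close>

definition times_set :: "(real \<Rightarrow> complex) \<Rightarrow> (real \<Rightarrow> complex) set \<Rightarrow> (real \<Rightarrow> complex) set" where
  "times_set F K = {\<phi> \<in> borel_measurable lebesgue.
     \<exists>\<psi> \<in> K. AE x in lebesgue. \<phi> x = F x * \<psi> x}"

definition cayley :: "real \<Rightarrow> complex" where
  "cayley \<xi> = (complex_of_real \<xi> - \<i>) / (complex_of_real \<xi> + \<i>)"

definition branch_cut :: "complex set \<Rightarrow> bool" where
  "branch_cut \<Gamma> \<longleftrightarrow> (\<exists>\<gamma> :: real \<Rightarrow> complex. continuous_on {0..} \<gamma> \<and> inj_on \<gamma> {0..} \<and>
     \<gamma> 0 = 0 \<and> filterlim \<gamma> at_infinity at_top \<and> \<Gamma> = \<gamma> ` {0..})"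

text \<open>
  \<open>L\<close> is a logarithm with a branch cut meeting the unit circle only at \<open>cayley c\<close>, normalised at \<open>1\<close>.
  The values of \<open>L\<close> on the cut are unconstrained; on the unit circle this concerns only the point
  \<open>cayley c\<close>.
\<close>

definition log_branch :: "real \<Rightarrow> (complex \<Rightarrow> complex) \<Rightarrow> bool" where
  "log_branch c L \<longleftrightarrow> (\<exists>\<Gamma>. branch_cut \<Gamma> \<and> \<Gamma> \<inter> sphere 0 1 = {cayley c} \<and>
     L holomorphic_on - \<Gamma> \<and> (\<forall>z \<in> - \<Gamma>. exp (L z) = z) \<and> L 1 = 0)"

definition r_fun :: "(complex \<Rightarrow> complex) \<Rightarrow> complex \<Rightarrow> real \<Rightarrow> complex" where
  "r_fun L \<alpha> \<xi> = exp (\<alpha> * L (cayley \<xi>))"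

text \<open>
  \<open>M\<close> is a branch of \<open>log ((z + \<i>) / (z - c))\<close> analytic in the upper half-plane, extended continuously
  to the real line without \<open>c\<close>.
\<close>

definition quotient_log_branch :: "real \<Rightarrow> (complex \<Rightarrow> complex) \<Rightarrow> bool" where
  "quotient_log_branch c M \<longleftrightarrow> M holomorphic_on upper_halfplane \<and>
     continuous_on ({z. 0 \<le> Im z} - {complex_of_real c}) M \<and>
     (\<forall>z \<in> {z. 0 \<le> Im z} - {complex_of_real c}. exp (M z) = (z + \<i>) / (z - complex_of_real c))"

definition quotient_power :: "(complex \<Rightarrow> complex) \<Rightarrow> complex \<Rightarrow> real \<Rightarrow> complex" where
  "quotient_power M \<alpha> \<xi> = exp (\<alpha> * M (complex_of_real \<xi>))"

text \<open>Both kinds of branches exist.\<close>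

lemma real_plus_i_nonzero: "complex_of_real c + \<i> \<noteq> 0"
  by (simp add: complex_eq_iff)

lemma cayley_neq_1: "cayley c \<noteq> 1"
proof
  assume "cayley c = 1"
  then have "complex_of_real c - \<i> = complex_of_real c + \<i>"
    using real_plus_i_nonzero[of c] by (simp add: cayley_def)
  then show False by (simp add: complex_eq_iff)
qed

lemma norm_cayley: "norm (cayley c) = 1"
proof -
  have "norm (complex_of_real c - \<i>) = norm (complex_of_real c + \<i>)"
    by (simp add: cmod_def)
  then show ?thesis
    using real_plus_i_nonzero[of c] by (simp add: cayley_def norm_divide)
qed

lemma log_branch_exists: "\<exists>L. log_branch c L"
proof -
  define w where "w = cayley c"
  have w: "norm w = 1" "w \<noteq> 1" "w \<noteq> 0"
    using norm_cayley[of c] cayley_neq_1[of c] by (auto simp: w_def)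
  define \<gamma> where "\<gamma> t = complex_of_real t * w" for t
  define L where "L z = Ln (- z / w) - Ln (- 1 / w)" for z
  define \<Gamma> where "\<Gamma> = \<gamma> ` {0..}"
  have "filterlim \<gamma> at_infinity at_top"
    unfolding filterlim_at_infinity_conv_norm_at_top using w
    by (simp add: \<gamma>_def norm_mult filterlim_abs_real)
  moreover have "continuous_on {0..} \<gamma>" "inj_on \<gamma> {0..}" "\<gamma> 0 = 0"
    using w by (auto simp: \<gamma>_def inj_on_def intro!: continuous_intros)
  ultimately have "branch_cut \<Gamma>"
    unfolding branch_cut_def \<Gamma>_def by blast
  moreover have "\<Gamma> \<inter> sphere 0 1 = {w}"
    using w by (force simp: \<Gamma>_def \<gamma>_def norm_mult)
  moreover have nonpos: "- z / w \<notin> \<real>\<^sub>\<le>\<^sub>0" if "z \<in> - \<Gamma>" for z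
  proof
    assume "- z / w \<in> \<real>\<^sub>\<le>\<^sub>0"
    then obtain t where t: "- z / w = complex_of_real t" "t \<le> 0"
      by (rule nonpos_Reals_cases)
    then have "z = \<gamma> (- t)"
      using w by (simp add: \<gamma>_def field_simps) (metis add.inverse_inverse)
    then show False
      using that t(2) by (auto simp: \<Gamma>_def)
  qed
  moreover have "L holomorphic_on - \<Gamma>"
    unfolding L_def using w nonpos by (intro holomorphic_intros) auto
  moreover have "exp (L z) = z" if "z \<in> - \<Gamma>" for z
  proof -
    have "0 \<in> \<Gamma>" by (force simp: \<Gamma>_def \<gamma>_def)
    then have "z \<noteq> 0" using that by auto
    then show ?thesis using w by (simp add: L_def exp_diff)
  qed
  moreover have "L 1 = 0" by (simp add: L_def)
  ultimately have "log_branch c L"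
    unfolding log_branch_def w_def[symmetric] by blast
  then show ?thesis by blast
qed

lemma quotient_log_branch_exists: "\<exists>M. quotient_log_branch c M"
proof -
  define M where "M z = Ln ((z + \<i>) / (z - complex_of_real c))" for z
  have nonpos: "(z + \<i>) / (z - complex_of_real c) \<notin> \<real>\<^sub>\<le>\<^sub>0"
    if "0 \<le> Im z" "z \<noteq> complex_of_real c" for z
  proof
    assume "(z + \<i>) / (z - complex_of_real c) \<in> \<real>\<^sub>\<le>\<^sub>0"
    then obtain t where t: "(z + \<i>) / (z - complex_of_real c) = complex_of_real t" "t \<le> 0"
      by (rule nonpos_Reals_cases)
    then have "z + \<i> = complex_of_real t * (z - complex_of_real c)"
      using that by (simp add: field_simps)
    then have "Im (z + \<i>) = Im (complex_of_real t * (z - complex_of_real c))"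
      by (rule arg_cong)
    then have "Im z + 1 = t * Im z"
      by simp
    moreover have "t * Im z \<le> 0"
      using t(2) that(1) by (simp add: mult_nonpos_nonneg)
    ultimately show False using that(1) by linarith
  qed
  have "M holomorphic_on upper_halfplane"
    unfolding M_def upper_halfplane_def
  proof (intro holomorphic_intros)
    fix z assume z: "z \<in> {z. 0 < Im z}"
    then have "z \<noteq> complex_of_real c" by auto
    then show "z - complex_of_real c \<noteq> 0" "(z + \<i>) / (z - complex_of_real c) \<notin> \<real>\<^sub>\<le>\<^sub>0"
      using nonpos[of z] z by auto
  qed
  moreover have "continuous_on ({z. 0 \<le> Im z} - {complex_of_real c}) M"
    unfolding M_def using nonpos by (intro continuous_intros) auto
  moreover have "exp (M z) = (z + \<i>) / (z - complex_of_real c)"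
    if "z \<in> {z. 0 \<le> Im z} - {complex_of_real c}" for z
    using that nonpos[of z] unfolding M_def by (subst exp_Ln) auto
  ultimately show ?thesis
    unfolding quotient_log_branch_def by blast
qed

end

theory Submission
  imports Defs "HOL-Complex_Analysis.Complex_Analysis" "HOL-Probability.Probability"
begin

text \<open>
  With \<open>Q = ((\<xi> + \<i>) / (\<xi> - c))\<^sup>\<alpha>\<close> one has \<open>r Q = \<kappa> cnj Q\<close> almost everywhere for a unimodular
  constant \<open>\<kappa>\<close>, and \<open>|r| = 1\<close>. Since \<open>1/Q\<close> is bounded and analytic in the upper half-plane, dividing
  by \<open>Q\<close> maps \<open>ker T\<^sub>g\<close> into \<open>ker T\<^sub>f\<close>. Conversely, for \<open>\<psi> \<in> ker T\<^sub>f\<close> the conjugate of \<open>g Q \<psi>\<close> is a constant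
  multiple of \<open>Q h\<close> with \<open>h = cnj (f \<psi>) \<in> H\<^sub>p\<^sup>+\<close>, so the point is that \<open>Q h \<in> L\<^sub>p\<close> forces \<open>Q h \<in> H\<^sub>p\<^sup>+\<close>.
  This special case of Smirnov's theorem follows by applying the inequality
  \<open>\<integral> |F(x + \<i>y)|\<^sup>p dx \<le> \<integral> |F(x)|\<^sup>p dx\<close> to \<open>F(z) = Q(z + \<i>\<epsilon>) h(z)\<close> and letting \<open>\<epsilon> \<longlongrightarrow> 0\<close>. The inequality
  itself comes from the Poisson representation of \<open>F\<close> and Jensen's inequality.
\<close>

subsection \<open>Integrals of powers\<close>

text \<open>The relation between r and Q rests on an identity: with q = (\<xi> + i) / (\<xi> - c)
  and \<xi> - c real, the Cayley quotient (\<xi> - i) / (\<xi> + i) equals cnj q / q. The two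
  inclusions differ in depth. Division by Q preserves H_p^+ outright, whereas multiplication by Q
  can leave L_p, since |Q| grows like |\<xi> - c|^(-\<alpha>) at c. The intersection with D(T_g)
  supplies exactly the missing integrability, because |g Q \<psi>| = |Q h| almost everywhere. The
  obvious Hardy bound for Q(z + i\<epsilon>) h(z), the supremum of the first factor times the norm
  of h, blows up as \<epsilon> tends to 0. Hence the need for an estimate by the boundary norm whose
  constant does not depend on the function. Only Q is translated: on the real line its translate is
  compared pointwise with Q, and translating h too would destroy the comparison with Q h.\<close>

lemma le_one_plus_powr:
  fixes u p :: real
  assumes "0 \<le> u" "1 \<le> p"
  shows "u \<le> 1 + u powr p"
proof (cases "u \<le> 1")
  case False
  then have "u powr 1 \<le> u powr p"
    using assms by (intro powr_mono) auto
  then show ?thesis using False by simp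
qed (use assms in \<open>auto intro: order_trans[where y=1]\<close>)

text \<open>Where \<open>u > R\<close>, write \<open>u = u powr p * u powr (1 - p)\<close>; the last
  factor is at most \<open>R powr (1 - p)\<close>. This is the tail estimate behind uniform
  integrability.\<close>

lemma le_min_plus_powr:
  fixes u p R :: real
  assumes "0 \<le> u" "1 \<le> p" "0 < R"
  shows "u \<le> min u R + u powr p / R powr (p - 1)"
proof (cases "u \<le> R")
  case False
  then have "R powr (p - 1) \<le> u powr (p - 1)"
    using assms by (intro powr_mono2) auto
  then have "u * R powr (p - 1) \<le> u * u powr (p - 1)"
    using assms by (intro mult_left_mono) auto
  also have "\<dots> = u powr p"
    using False assms by (simp add: powr_mult_base)
  finally have "u \<le> u powr p / R powr (p - 1)"
    using assms by (simp add: field_simps)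
  then show ?thesis using assms by (auto simp: min_def)
qed (use assms in auto)

text \<open>A sum is at most twice the larger term. The crude factor \<open>2 powr p\<close>
  suffices, since only a bound uniform in the functions is wanted.\<close>

lemma powr_add_le:
  fixes a b p :: real
  assumes "0 \<le> a" "0 \<le> b" "0 \<le> p"
  shows "(a + b) powr p \<le> 2 powr p * (a powr p + b powr p)"
proof -
  have "(a + b) powr p \<le> (2 * max a b) powr p"
    using assms by (intro powr_mono2) auto
  also have "\<dots> = 2 powr p * max a b powr p"
    using assms by (simp add: powr_mult)
  also have "max a b powr p \<le> a powr p + b powr p"
    by (simp add: max_def)
  finally show ?thesis by simp
qed

text \<open>The supporting line at \<open>m\<close> is what Jensen's inequality integrates.
  Convexity is taken on the open half-line, where the derivative exists, so \<open>u = 0\<close> is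
  checked by hand.\<close>

lemma powr_above_tangent:
  fixes u m p :: real
  assumes "0 \<le> u" "0 < m" "1 \<le> p"
  shows "m powr p + p * m powr (p - 1) * (u - m) \<le> u powr p"
proof (cases "u = 0")
  case True
  have "m powr (p - 1) * m = m powr p"
    using assms by (simp add: powr_diff)
  then have "m powr p + p * m powr (p - 1) * (0 - m) = (1 - p) * m powr p"
    by (simp add: algebra_simps)
  also have "\<dots> \<le> 0"
    using assms by (simp add: mult_nonpos_nonneg)
  finally show ?thesis using True by simp
next
  case False
  have "((\<lambda>x. x powr p) has_real_derivative p * m powr (p - 1)) (at m within {0<..})"
    using assms by (auto intro!: derivative_eq_intros)
  then have "u powr p - m powr p \<ge> p * m powr (p - 1) * (u - m)"
    using assms False interior_open[of "{0<..} :: real set"]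
    by (intro convex_on_imp_above_tangent[OF powr_convex]) (auto)
  then show ?thesis by simp
qed

lemma (in finite_measure) integrable_of_powr_integrable:
  fixes f :: "'a \<Rightarrow> 'b::{banach, second_countable_topology}"
  assumes [measurable]: "f \<in> borel_measurable M"
    and fin: "(\<integral>\<^sup>+x. ennreal (norm (f x) powr p) \<partial>M) < \<infinity>" and "1 \<le> p"
  shows "integrable M f"
proof (rule Bochner_Integration.integrable_bound)
  have "integrable M (\<lambda>x. norm (f x) powr p)"
    using fin by (intro integrableI_bounded) auto
  then show "integrable M (\<lambda>x. 1 + norm (f x) powr p)"
    by simp
qed (use \<open>1 \<le> p\<close> le_one_plus_powr in \<open>auto simp: order_trans[OF _ abs_ge_self]\<close>)

text \<open>Jensen's inequality for the norm: when the tangent at the mean \<open>m\<close> of the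
  norm is integrated, its linear term vanishes. For \<open>m = 0\<close> there is no tangent, but
  the left side is 0; an infinite right side is trivial.\<close>

lemma (in prob_space) norm_expectation_powr_le:
  fixes f :: "'a \<Rightarrow> 'b::{banach, second_countable_topology}"
  assumes int: "integrable M f" and p: "1 \<le> p"
  shows "ennreal (norm (\<integral>x. f x \<partial>M) powr p) \<le> (\<integral>\<^sup>+x. ennreal (norm (f x) powr p) \<partial>M)"
proof (cases "(\<integral>\<^sup>+x. ennreal (norm (f x) powr p) \<partial>M) < \<infinity>")
  case True
  have [measurable]: "f \<in> borel_measurable M" using int by auto
  define m where "m = (\<integral>x. norm (f x) \<partial>M)"
  have m: "norm (\<integral>x. f x \<partial>M) \<le> m"
    unfolding m_def by (rule integral_norm_bound)
  have int': "integrable M (\<lambda>x. norm (f x) powr p)"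
    using True by (intro integrableI_bounded) auto
  have "m powr p \<le> (\<integral>x. norm (f x) powr p \<partial>M)"
  proof (cases "m > 0")
    case True
    have "(\<integral>x. m powr p + p * m powr (p - 1) * (norm (f x) - m) \<partial>M) \<le> (\<integral>x. norm (f x) powr p \<partial>M)"
      using int int' p True by (intro integral_mono) (auto intro!: powr_above_tangent)
    also have "(\<integral>x. m powr p + p * m powr (p - 1) * (norm (f x) - m) \<partial>M) = m powr p"
      using int by (simp add: m_def prob_space)
    finally show ?thesis .
  next
    case False
    then have "m = 0" unfolding m_def by (simp add: not_less antisym)
    then show ?thesis by simp
  qed
  then have "norm (\<integral>x. f x \<partial>M) powr p \<le> (\<integral>x. norm (f x) powr p \<partial>M)"
    using m p by (meson norm_ge_zero order_trans powr_mono2 zero_le_one)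
  then show ?thesis
    by (simp add: nn_integral_eq_integral[OF int'])
next
  case False
  then have "(\<integral>\<^sup>+x. ennreal (norm (f x) powr p) \<partial>M) = \<top>"
    unfolding infinity_ennreal_def less_top[symmetric] by blast
  then show ?thesis by simp
qed

text \<open>
  A form of Vitali's convergence theorem: uniformly in \<open>n\<close>, the part of \<open>|g n - f|\<close> above the height \<open>R\<close>
  contributes only \<open>O(R\<^sup>1\<^sup>-\<^sup>p)\<close> to the integral.
\<close>

lemma (in finite_measure) tendsto_integral_of_powr_bounded:
  fixes f :: "'a \<Rightarrow> 'b::{banach, second_countable_topology}"
  assumes [measurable]: "\<And>n. g n \<in> borel_measurable M" "f \<in> borel_measurable M"
    and lim: "AE x in M. (\<lambda>n. g n x) \<longlonglongrightarrow> f x"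
    and bound: "\<And>n. (\<integral>\<^sup>+x. ennreal (norm (g n x) powr p) \<partial>M) \<le> ennreal C"
    and boundf: "(\<integral>\<^sup>+x. ennreal (norm (f x) powr p) \<partial>M) \<le> ennreal C"
    and p: "1 < p"
  shows "(\<lambda>n. \<integral>x. g n x \<partial>M) \<longlonglongrightarrow> (\<integral>x. f x \<partial>M)"
proof -
  have fin: "integrable M (\<lambda>x. norm (h x) powr p)" "integrable M h"
    if [measurable]: "h \<in> borel_measurable M"
      and "(\<integral>\<^sup>+x. ennreal (norm (h x) powr p) \<partial>M) \<le> ennreal C" for h :: "'a \<Rightarrow> 'b"
  proof -
    have *: "(\<integral>\<^sup>+x. ennreal (norm (h x) powr p) \<partial>M) < \<infinity>"
      using that(2) by (auto simp: order_le_less_trans)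
    show "integrable M (\<lambda>x. norm (h x) powr p)"
      using * by (intro integrableI_bounded) auto
    show "integrable M h"
      using * p by (intro integrable_of_powr_integrable) auto
  qed
  \<comment> \<open>\<open>C\<close> carries no sign, and \<open>ennreal C\<close> is 0 for negative
    \<open>C\<close>; hence \<open>max C 0\<close>.\<close>
  have le_C: "(\<integral>x. norm (h x) powr p \<partial>M) \<le> max C 0"
    if "h \<in> borel_measurable M"
      and "(\<integral>\<^sup>+x. ennreal (norm (h x) powr p) \<partial>M) \<le> ennreal C" for h :: "'a \<Rightarrow> 'b"
    using that(2) unfolding nn_integral_eq_integral[OF fin(1)[OF that] AE_I2[OF powr_ge_zero]]
    by (auto simp: ennreal_le_iff2 max_def)
  have ints: "integrable M (g n)" "integrable M (\<lambda>x. norm (g n x) powr p)"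
    "integrable M f" "integrable M (\<lambda>x. norm (f x) powr p)" for n
    by (rule fin[OF assms(1) bound] fin[OF assms(2) boundf])+
  define u where "u n x = norm (g n x - f x)" for n x
  have [measurable]: "u n \<in> borel_measurable M" for n
    unfolding u_def by measurable
  have u_nonneg: "0 \<le> u n x" for n x
    by (simp add: u_def)
  have int_u: "integrable M (u n)" for n
    unfolding u_def by (intro integrable_norm Bochner_Integration.integrable_diff ints)
  \<comment> \<open>\<open>u n x powr p\<close> is at most \<open>2 powr p\<close> times a sum of
    two powers, each with integral at most \<open>max C 0\<close>.\<close>
  define D where "D = 2 powr p * (2 * max C 0)"
  have up_le: "u n x powr p \<le> 2 powr p * (norm (g n x) powr p + norm (f x) powr p)" for n x
  proof -
    have "u n x powr p \<le> (norm (g n x) + norm (f x)) powr p"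
      unfolding u_def using p by (intro powr_mono2 norm_triangle_ineq4) auto
    also have "\<dots> \<le> 2 powr p * (norm (g n x) powr p + norm (f x) powr p)"
      using p by (intro powr_add_le) auto
    finally show ?thesis .
  qed
  have int_up: "integrable M (\<lambda>x. u n x powr p)" for n
  proof (rule Bochner_Integration.integrable_bound)
    show "integrable M (\<lambda>x. 2 powr p * (norm (g n x) powr p + norm (f x) powr p))"
      by (intro integrable_mult_right Bochner_Integration.integrable_add ints)
    show "AE x in M. norm (u n x powr p) \<le> norm (2 powr p * (norm (g n x) powr p + norm (f x) powr p))"
      using up_le[of n] by (intro AE_I2) (simp add: abs_of_nonneg)
  qed measurable
  have D: "(\<integral>x. u n x powr p \<partial>M) \<le> D" for n
  proof -
    have "(\<integral>x. u n x powr p \<partial>M) \<le> (\<integral>x. 2 powr p * (norm (g n x) powr p + norm (f x) powr p) \<partial>M)"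
      by (intro integral_mono int_up up_le integrable_mult_right Bochner_Integration.integrable_add ints)
    also have "\<dots> = 2 powr p * ((\<integral>x. norm (g n x) powr p \<partial>M) + (\<integral>x. norm (f x) powr p \<partial>M))"
      unfolding integral_mult_right_zero by (subst Bochner_Integration.integral_add) (rule ints refl)+
    also have "\<dots> \<le> D"
      unfolding D_def mult_2
      by (intro mult_left_mono add_mono le_C[OF assms(1) bound] le_C[OF assms(2) boundf] powr_ge_zero)
    finally show ?thesis .
  qed
  have "(\<lambda>n. \<integral>x. u n x \<partial>M) \<longlonglongrightarrow> 0"
  proof (rule LIMSEQ_I)
    fix e :: real assume "0 < e"
    have "((\<lambda>R. D / R powr (p - 1)) \<longlongrightarrow> 0) at_top"
      using p by real_asymp
    then have "\<forall>\<^sub>F R in at_top. D / R powr (p - 1) < e / 2 \<and> R > 0"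
      using \<open>0 < e\<close> eventually_gt_at_top[of 0]
      by (intro eventually_conj) (auto dest: order_tendstoD(2)[of _ _ _ "e/2"])
    then obtain R where R: "D / R powr (p - 1) < e / 2" "R > 0"
      by (auto dest: eventually_happens)
    \<comment> \<open>After truncation the constant \<open>R\<close> is a majorant, integrable
      because the measure is finite.\<close>
    have "(\<lambda>n. \<integral>x. min (u n x) R \<partial>M) \<longlonglongrightarrow> (\<integral>x. 0 \<partial>M)"
    proof (rule integral_dominated_convergence[where w="\<lambda>_. R"])
      show "AE x in M. (\<lambda>n. min (u n x) R) \<longlonglongrightarrow> 0"
        using lim
      proof eventually_elim
        case (elim x)
        then have "(\<lambda>n. u n x) \<longlonglongrightarrow> 0"
          unfolding u_def using tendsto_norm_zero[OF LIM_zero[OF elim]] by simp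
        then have "(\<lambda>n. min (u n x) R) \<longlonglongrightarrow> min 0 R"
          by (intro tendsto_intros)
        then show ?case using R by simp
      qed
      show "AE x in M. norm (min (u n x) R) \<le> R" for n
        using R by (auto simp: u_def)
    qed auto
    then have "\<forall>\<^sub>F n in sequentially. (\<integral>x. min (u n x) R \<partial>M) < e / 2"
      using \<open>0 < e\<close> by (auto dest: order_tendstoD(2)[of _ _ _ "e/2"])
    then obtain N where N: "\<And>n. n \<ge> N \<Longrightarrow> (\<integral>x. min (u n x) R \<partial>M) < e / 2"
      by (auto simp: eventually_sequentially)
    have "norm ((\<integral>x. u n x \<partial>M) - 0) < e" if "n \<ge> N" for n
    proof -
      have int_min: "integrable M (\<lambda>x. min (u n x) R)"
        using R u_nonneg by (intro Bochner_Integration.integrable_bound[OF int_u[of n]]) auto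
      have "(\<integral>x. u n x \<partial>M) \<le> (\<integral>x. min (u n x) R + u n x powr p / R powr (p - 1) \<partial>M)"
        using R p by (intro integral_mono int_u Bochner_Integration.integrable_add integrable_divide_zero
            int_min int_up le_min_plus_powr u_nonneg) auto
      also have "\<dots> = (\<integral>x. min (u n x) R \<partial>M) + (\<integral>x. u n x powr p \<partial>M) / R powr (p - 1)"
        using int_up[of n] int_min by (subst Bochner_Integration.integral_add) auto
      also have "\<dots> \<le> (\<integral>x. min (u n x) R \<partial>M) + D / R powr (p - 1)"
        using D by (intro add_left_mono divide_right_mono) auto
      also have "\<dots> < e"
        using N[OF that] R(1) by linarith
      finally show ?thesis using u_nonneg by simp
    qed
    then show "\<exists>N. \<forall>n\<ge>N. norm ((\<integral>x. u n x \<partial>M) - 0) < e" by blast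
  qed
  then have "(\<lambda>n. (\<integral>x. g n x \<partial>M) - (\<integral>x. f x \<partial>M)) \<longlonglongrightarrow> 0"
  proof (rule Lim_null_comparison[rotated], intro always_eventually allI)
    fix n
    have "(\<integral>x. g n x \<partial>M) - (\<integral>x. f x \<partial>M) = (\<integral>x. g n x - f x \<partial>M)"
      by (intro Bochner_Integration.integral_diff[symmetric] ints)
    then show "norm ((\<integral>x. g n x \<partial>M) - (\<integral>x. f x \<partial>M)) \<le> (\<integral>x. u n x \<partial>M)"
      unfolding u_def by (metis integral_norm_bound)
  qed
  then show ?thesis by (rule LIM_zero_cancel)
qed

subsection \<open>The Poisson kernel\<close>

definition poisson :: "real \<Rightarrow> real \<Rightarrow> real" where
  "poisson y s = y / (pi * (s\<^sup>2 + y\<^sup>2))"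

lemma poisson_measurable [measurable]: "poisson y \<in> borel_measurable borel"
  unfolding poisson_def by measurable

lemma poisson_nonneg: "0 < y \<Longrightarrow> 0 \<le> poisson y s"
  by (simp add: poisson_def)

lemma poisson_minus_commute: "poisson y (s - t) = poisson y (t - s)"
  by (simp add: poisson_def power2_commute)

text \<open>The maximum is at \<open>s = 0\<close>. It lets a bound for an integral against Lebesgue
  measure pass to the Poisson measure.\<close>

lemma poisson_le:
  assumes "0 < y"
  shows "poisson y s \<le> 1 / (pi * y)"
proof -
  have "poisson y s \<le> y / (pi * y\<^sup>2)"
    unfolding poisson_def using assms by (intro divide_left_mono mult_left_mono mult_pos_pos) (auto intro: add_nonneg_pos)
  then show ?thesis
    using assms by (simp add: power2_eq_square)
qed

lemma nn_integral_inverse_1_plus_square: "(\<integral>\<^sup>+t. ennreal (inverse (1 + t\<^sup>2)) \<partial>lborel) = ennreal pi"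
proof -
  have "integrable lborel (\<lambda>t::real. inverse (1 + t\<^sup>2))"
    using integrable_inverse_1_plus_square by (simp add: set_integrable_def)
  moreover have "(\<integral>t. inverse (1 + t\<^sup>2) \<partial>lborel) = pi"
    using LBINT_inverse_1_plus_square
    by (simp add: interval_lebesgue_integral_def set_lebesgue_integral_def)
  ultimately show ?thesis
    by (subst nn_integral_eq_integral) (auto simp: add_nonneg_nonneg)
qed

text \<open>The substitution \<open>t = (s - x) / y\<close> leads to the arctangent
  integral.\<close>

lemma nn_integral_poisson:
  assumes "0 < y"
  shows "(\<integral>\<^sup>+s. ennreal (poisson y (s - x)) \<partial>lborel) = 1"
proof -
  have "(\<integral>\<^sup>+t. ennreal (inverse (1 + t\<^sup>2) / pi) \<partial>lborel) =
      \<bar>1 / y\<bar> * (\<integral>\<^sup>+s. ennreal (inverse (1 + (- x / y + 1 / y * s)\<^sup>2) / pi) \<partial>lborel)"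
    using assms by (intro nn_integral_real_affine) auto
  also have "\<dots> = (\<integral>\<^sup>+s. ennreal (1 / y) * ennreal (inverse (1 + (- x / y + 1 / y * s)\<^sup>2) / pi) \<partial>lborel)"
    using assms by (subst nn_integral_cmult) auto
  also have "\<dots> = (\<integral>\<^sup>+s. ennreal (poisson y (s - x)) \<partial>lborel)"
  proof (intro nn_integral_cong)
    fix s
    have eq: "1 + (- x / y + 1 / y * s)\<^sup>2 = ((s - x)\<^sup>2 + y\<^sup>2) / y\<^sup>2"
      using assms by (simp add: field_simps power2_eq_square)
    have "1 / y * (inverse (1 + (- x / y + 1 / y * s)\<^sup>2) / pi) = poisson y (s - x)"
      unfolding eq using assms by (simp add: poisson_def field_simps power2_eq_square)
    then show "ennreal (1 / y) * ennreal (inverse (1 + (- x / y + 1 / y * s)\<^sup>2) / pi) = ennreal (poisson y (s - x))"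
      using assms by (subst ennreal_mult'[symmetric]) auto
  qed
  also have "(\<integral>\<^sup>+t. ennreal (inverse (1 + t\<^sup>2) / pi) \<partial>lborel) =
      (\<integral>\<^sup>+t. ennreal (1 / pi) * ennreal (inverse (1 + t\<^sup>2)) \<partial>lborel)"
    by (intro nn_integral_cong, subst ennreal_mult'[symmetric]) (auto simp: field_simps)
  also have "\<dots> = ennreal (1 / pi) * ennreal pi"
    by (subst nn_integral_cmult) (auto simp: nn_integral_inverse_1_plus_square)
  also have "\<dots> = 1"
    by (subst ennreal_mult'[symmetric]) auto
  finally show ?thesis by simp
qed

text \<open>Turns a Poisson integral into an expectation, so that Jensen's inequality applies with
  constant 1.\<close>

lemma prob_space_poisson:
  assumes "0 < y"
  shows "prob_space (density lborel (\<lambda>t. ennreal (poisson y (t - x))))"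
  by (rule prob_spaceI) (simp add: emeasure_density nn_integral_poisson[OF assms])

lemma continuous_on_Complex [continuous_intros]:
  assumes "continuous_on A f" "continuous_on A g"
  shows "continuous_on A (\<lambda>x. Complex (f x) (g x))"
  unfolding Complex_eq using assms by (intro continuous_intros)

lemma borel_measurable_Complex [measurable (raw)]:
  assumes "f \<in> borel_measurable M" "g \<in> borel_measurable M"
  shows "(\<lambda>x. Complex (f x) (g x)) \<in> borel_measurable M"
  unfolding Complex_eq using assms by measurable

lemma continuous_on_horizontal_line:
  assumes "continuous_on {z. a < Im z} G" "a < y"
  shows "continuous_on UNIV (\<lambda>t. G (Complex t y))"
  using assms by (intro continuous_on_compose2[OF assms(1)] continuous_intros) auto

lemma ennreal_mult_add_mult:
  assumes "0 \<le> a" "0 \<le> b" "0 \<le> c" "0 \<le> d"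
  shows "ennreal (a * b + c * d) = ennreal a * ennreal b + ennreal c * ennreal d"
  using assms by (simp add: ennreal_mult)

text \<open>Otherwise \<open>\<Phi> R + \<Phi> (- R)\<close> would be at least 1 on a half-line,
  whose measure is infinite. Both signs are handled at once because a rectangle symmetric about 0
  needs both of its vertical sides small.\<close>

lemma exists_symmetric_pair_le_1:
  fixes \<Phi> :: "real \<Rightarrow> ennreal"
  assumes [measurable]: "\<Phi> \<in> borel_measurable borel"
    and fin: "(\<integral>\<^sup>+x. \<Phi> x \<partial>lborel) < \<infinity>"
  shows "\<exists>R\<ge>N. \<Phi> R \<le> 1 \<and> \<Phi> (- R) \<le> 1"
proof (rule ccontr)
  assume "\<not> ?thesis"
  then have *: "1 \<le> \<Phi> R + \<Phi> (- R)" if "R \<ge> N" for R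
    using that by (metis add_increasing add_increasing2 linear zero_le)
  have "emeasure lborel {N..} = \<infinity>"
  proof (rule ccontr)
    assume "emeasure lborel {N..} \<noteq> \<infinity>"
    then have "ennreal (real n) \<le> emeasure lborel {N..}" for n
      using emeasure_mono[of "{N..N + real n}" "{N..}" lborel] by auto
    then show False
      using \<open>emeasure lborel {N..} \<noteq> \<infinity>\<close>
      by (metis ennreal_of_nat_eq_real_of_nat ennreal_Ex_less_of_nat infinity_ennreal_def less_top linorder_not_less)
  qed
  then have "\<infinity> = (\<integral>\<^sup>+x. indicator {N..} x \<partial>lborel)"
    by simp
  also have "\<dots> \<le> (\<integral>\<^sup>+x. \<Phi> x + \<Phi> (- x) \<partial>lborel)"
    using * by (intro nn_integral_mono) (auto split: split_indicator)
  also have "\<dots> = (\<integral>\<^sup>+x. \<Phi> x \<partial>lborel) + (\<integral>\<^sup>+x. \<Phi> (- x) \<partial>lborel)"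
    by (intro nn_integral_add) auto
  also have "(\<integral>\<^sup>+x. \<Phi> (- x) \<partial>lborel) = (\<integral>\<^sup>+x. \<Phi> x \<partial>lborel)"
    using nn_integral_real_affine[of \<Phi> "-1" 0] by simp
  also have "(\<integral>\<^sup>+x. \<Phi> x \<partial>lborel) + (\<integral>\<^sup>+x. \<Phi> x \<partial>lborel) < \<infinity>"
    using fin by simp
  finally show False by simp
qed

text \<open>
  Integrating over the boundary of the rectangle \<open>[-R, R] \<times> [0, T]\<close> the holomorphic function
  \<open>(G(w) - G(z)) / ((w - z) (w - cnj z))\<close>, which has no pole at \<open>z\<close>, avoids winding numbers. No pointwise
  bound on \<open>G\<close> is at hand, so \<open>R\<close> is selected by Tonelli's theorem to make the vertical sides small.
\<close>

lemma poisson_representation: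
  fixes G :: "complex \<Rightarrow> complex"
  assumes hol: "G holomorphic_on {z. - \<eta> < Im z}" and "0 < \<eta>" and p: "1 \<le> p" and C: "0 \<le> C"
    and bound: "\<And>y. 0 \<le> y \<Longrightarrow> (\<integral>\<^sup>+t. ennreal (norm (G (Complex t y)) powr p) \<partial>lborel) \<le> ennreal C"
    and y: "0 < y"
  shows "G (Complex x y) = (\<integral>t. poisson y (t - x) *\<^sub>R G (Complex t 0) \<partial>lborel)"
proof -
  define z where "z = Complex x y"
  \<comment> \<open>\<open>G\<close> is holomorphic above height \<open>- \<eta>\<close>, and the
    remaining pole \<open>cnj z\<close> lies at height \<open>- y\<close>, just outside
    \<open>S\<close>.\<close>
  define S where "S = {w. - min \<eta> y < Im w}"
  have S: "open S" "convex S" "z \<in> S"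
    using y \<open>0 < \<eta>\<close> by (auto simp: S_def z_def open_halfspace_Im_gt convex_halfspace_Im_gt)
  have inS: "w \<in> S" if "0 \<le> Im w" for w
    using that y \<open>0 < \<eta>\<close> by (auto simp: S_def)
  \<comment> \<open>At a real point the two linear factors multiply to
    \<open>(t - x)\<^sup>2 + y\<^sup>2\<close>, so \<open>k\<close> is there \<open>pi / y\<close>
    times the Poisson kernel times \<open>G t - G z\<close>. Since the kernel has mass 1, the claim
    says that \<open>k\<close> has integral 0 over the real line. The value \<open>deriv G z\<close>
    removes the singularity at \<open>z\<close>.\<close>
  define k where "k w = (if w = z then deriv G z else (G w - G z) / (w - z)) / (w - cnj z)" for w
  have "k holomorphic_on S"
    unfolding k_def
  proof (intro holomorphic_intros pole_lemma_open S)
    show "G holomorphic_on S"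
      by (rule holomorphic_on_subset[OF hol]) (auto simp: S_def)
    show "w - cnj z \<noteq> 0" if "w \<in> S" for w
      using that by (auto simp: S_def z_def complex_eq_iff)
  qed
  \<comment> \<open>With a primitive on the convex set \<open>S\<close>, each side of the rectangle
    contributes a difference of two corner values, and the sum around the rectangle cancels
    identically.\<close>
  then obtain K where "\<And>w. w \<in> S \<Longrightarrow> (K has_field_derivative k w) (at w within S)"
    using holomorphic_convex_primitive'[OF S(2,1)] by blast
  then have K: "(K has_field_derivative k w) (at w)" if "w \<in> S" for w
    using that at_within_open[OF that S(1)] by metis
  have cont_k: "continuous_on S k"
    using \<open>k holomorphic_on S\<close> by (rule holomorphic_on_imp_continuous_on)
  \<comment> \<open>Collects \<open>norm (G z)\<close> and the 1 in
    \<open>u \<le> 1 + u powr p\<close>, so that \<open>k\<close> is controlled by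
    \<open>norm (G w) powr p\<close>, the only quantity with an integral bound.\<close>
  define B where "B = 1 + norm (G z)"
  have B: "0 \<le> B" by (simp add: B_def)
  have k_le: "norm (k w) \<le> (B + norm (G w) powr p) / (norm (w - z))\<^sup>2" if "0 \<le> Im w" "w \<noteq> z" for w
  proof -
    \<comment> \<open>In the closed upper half-plane a point is at least as close to
      \<open>z\<close> as to the mirror image \<open>cnj z\<close>.\<close>
    have "(Im w - y)\<^sup>2 \<le> (Im w + y)\<^sup>2"
      using that y by (intro power2_le_iff_abs_le[THEN iffD2]) auto
    then have le: "norm (w - z) \<le> norm (w - cnj z)"
      by (auto simp: z_def cmod_def)
    have "norm (k w) = norm (G w - G z) / (norm (w - z) * norm (w - cnj z))"
      using that by (simp add: k_def norm_divide norm_mult)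
    also have "\<dots> \<le> norm (G w - G z) / (norm (w - z) * norm (w - z))"
      using that le by (intro divide_left_mono mult_left_mono mult_pos_pos)
        (auto intro: less_le_trans[of 0 "norm (w - z)"])
    also have "\<dots> \<le> (B + norm (G w) powr p) / (norm (w - z) * norm (w - z))"
      using norm_triangle_ineq4[of "G w" "G z"] le_one_plus_powr[OF norm_ge_zero p, of "G w"]
      by (intro divide_right_mono) (auto simp: B_def)
    finally show ?thesis by (simp add: power2_eq_square)
  qed
  have cont_line: "continuous_on UNIV (\<lambda>t. k (Complex t T))" if "0 \<le> T" for T
    by (intro continuous_on_compose2[OF cont_k] continuous_intros) (use inS that in auto)
  have cont_G: "continuous_on {w. 0 \<le> Im w} G"
    by (rule continuous_on_subset[OF holomorphic_on_imp_continuous_on[OF hol]]) (use \<open>0 < \<eta>\<close> in auto)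
  have cont_G_line: "continuous_on UNIV (\<lambda>t. G (Complex t T))" if "0 \<le> T" for T
    by (intro continuous_on_compose2[OF cont_G] continuous_intros) (use that in auto)
  have measurable_k: "(\<lambda>t. k (Complex t T)) \<in> borel_measurable borel" if "0 \<le> T" for T
    using cont_line[OF that] by (rule borel_measurable_continuous_onI)
  have measurable_G: "(\<lambda>t. G (Complex t T)) \<in> borel_measurable borel" if "0 \<le> T" for T
    using cont_G_line[OF that] by (rule borel_measurable_continuous_onI)
  \<comment> \<open>\<open>d\<close> is the distance of the line from \<open>z\<close>.
    \<open>T = 0\<close> gives integrability of \<open>k\<close> on the real line;
    \<open>T = y + d\<close> with large \<open>d\<close> makes the top side small, whatever the
    width of the rectangle.\<close>
  have line: "(\<integral>\<^sup>+t. ennreal (norm (k (Complex t T))) \<partial>lborel) \<le> ennreal (pi * B / d + C / d\<^sup>2)"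
    if T: "0 \<le> T" "\<bar>T - y\<bar> = d" "0 < d" for T d
  proof -
    have [measurable]: "(\<lambda>t. G (Complex t T)) \<in> borel_measurable borel"
      using T by (intro measurable_G)
    have "(\<integral>\<^sup>+t. ennreal (norm (k (Complex t T))) \<partial>lborel) \<le>
      (\<integral>\<^sup>+t. ennreal (pi * B / d) * ennreal (poisson d (t - x)) + ennreal (1 / d\<^sup>2) * ennreal (norm (G (Complex t T)) powr p) \<partial>lborel)"
    proof (intro nn_integral_mono)
      fix t
      have "norm (Complex t T - z) ^ 2 = (t - x)\<^sup>2 + d\<^sup>2"
        using T(2) by (auto simp: z_def cmod_def power2_eq_square[of "T - y"] power2_eq_square[of d] abs_mult_self_eq)
      moreover have "Complex t T \<noteq> z" using T by (auto simp: z_def)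
      ultimately have "norm (k (Complex t T)) \<le> (B + norm (G (Complex t T)) powr p) / ((t - x)\<^sup>2 + d\<^sup>2)"
        using k_le[of "Complex t T"] T by simp
      also have "\<dots> = pi * B / d * poisson d (t - x) + norm (G (Complex t T)) powr p / ((t - x)\<^sup>2 + d\<^sup>2)"
        using T by (simp add: poisson_def add_divide_distrib)
      also have "\<dots> \<le> pi * B / d * poisson d (t - x) + norm (G (Complex t T)) powr p / d\<^sup>2"
        using T by (intro add_left_mono divide_left_mono mult_pos_pos) (auto intro: add_nonneg_pos)
      finally have "ennreal (norm (k (Complex t T))) \<le> ennreal (pi * B / d * poisson d (t - x) + 1 / d\<^sup>2 * norm (G (Complex t T)) powr p)"
        by (intro ennreal_leI) simp
      also have "\<dots> = ennreal (pi * B / d) * ennreal (poisson d (t - x)) + ennreal (1 / d\<^sup>2) * ennreal (norm (G (Complex t T)) powr p)"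
        using T B poisson_nonneg[of d "t - x"] by (intro ennreal_mult_add_mult) auto
      finally show "ennreal (norm (k (Complex t T))) \<le> \<dots>" .
    qed
    also have "\<dots> = ennreal (pi * B / d) * 1 + ennreal (1 / d\<^sup>2) * (\<integral>\<^sup>+t. ennreal (norm (G (Complex t T)) powr p) \<partial>lborel)"
      using T by (subst nn_integral_add) (auto simp: nn_integral_cmult nn_integral_poisson)
    also have "\<dots> \<le> ennreal (pi * B / d) * 1 + ennreal (1 / d\<^sup>2) * ennreal C"
      using T by (intro add_left_mono mult_left_mono bound) auto
    also have "\<dots> = ennreal (pi * B / d * 1 + 1 / d\<^sup>2 * C)"
      using T B C by (subst ennreal_mult_add_mult) auto
    also have "\<dots> = ennreal (pi * B / d + C / d\<^sup>2)"
      by simp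
    finally show ?thesis .
  qed
  have horizontal: "(\<integral>t. indicator {-R..R} t *\<^sub>R k (Complex t T) \<partial>lborel) = K (Complex R T) - K (Complex (- R) T)"
    if "0 \<le> T" "0 \<le> R" for T R
  proof (intro integral_FTC_Icc)
    fix t
    have "((\<lambda>t. K (Complex t T)) has_vector_derivative 1 * k (Complex t T)) (at t)"
      using that inS by (intro field_vector_diff_chain_at[unfolded o_def, of _ 1] K)
        (auto simp: Complex_eq intro!: derivative_eq_intros)
    then show "((\<lambda>t. K (Complex t T)) has_vector_derivative k (Complex t T)) (at t within {-R..R})"
      by (auto intro: has_vector_derivative_at_within)
  qed (use that cont_line in \<open>auto intro: continuous_on_subset\<close>)
  \<comment> \<open>Nothing is known about \<open>G\<close> below height \<open>- \<eta>\<close>;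
    the indicator makes the integrand Borel measurable on the whole plane, as Tonelli's theorem
    requires.\<close>
  define u where "u r s = ennreal (norm (indicator {w. 0 \<le> Im w} (Complex r s) *\<^sub>R G (Complex r s)) powr p)" for r s
  have u: "u r s = ennreal (norm (G (Complex r s)) powr p)" if "0 \<le> s" for r s
    using that by (simp add: u_def)
  have [measurable]: "(\<lambda>w. indicator {w. 0 \<le> Im w} w *\<^sub>R G w) \<in> borel_measurable borel"
    using closed_halfspace_Im_ge[of 0] by (intro borel_measurable_continuous_on_indicator cont_G) auto
  have u1 [measurable]: "(\<lambda>w. ennreal (norm (indicator {w. 0 \<le> Im w} w *\<^sub>R G w) powr p)) \<in> borel_measurable borel"
    by measurable
  have [measurable]: "(\<lambda>(r, s). u r s) \<in> borel_measurable (borel \<Otimes>\<^sub>M borel)"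
    using measurable_compose[OF _ u1, of "\<lambda>(r, s). Complex r s" "borel \<Otimes>\<^sub>M borel"]
    by (simp add: split_def u_def del: norm_scaleR)
  have u_line [measurable]: "u r \<in> borel_measurable borel" for r
    using measurable_compose[OF _ u1, of "Complex r" borel] by (simp add: u_def[abs_def] del: norm_scaleR)
  define \<Phi> where "\<Phi> T r = (\<integral>\<^sup>+s. indicator {0..T} s * u r s \<partial>lborel)" for T r
  have [measurable]: "\<Phi> T \<in> borel_measurable borel" for T
    unfolding \<Phi>_def by measurable
  have \<Phi>: "(\<integral>\<^sup>+r. \<Phi> T r \<partial>lborel) < \<infinity>" if "0 \<le> T" for T
  proof -
    have "(\<integral>\<^sup>+r. \<Phi> T r \<partial>lborel) = (\<integral>\<^sup>+s. (\<integral>\<^sup>+r. indicator {0..T} s * u r s \<partial>lborel) \<partial>lborel)"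
      unfolding \<Phi>_def by (rule lborel_pair.Fubini') measurable
    also have "\<dots> \<le> (\<integral>\<^sup>+s. indicator {0..T} s * ennreal C \<partial>lborel)"
      using bound by (intro nn_integral_mono) (auto simp: indicator_def u)
    also have "\<dots> < \<infinity>"
      using that by (simp add: nn_integral_multc ennreal_mult_less_top)
    finally show ?thesis .
  qed
  \<comment> \<open>Here \<open>norm (w - z)\<close> is at least \<open>\<bar>r - x\<bar>\<close>.
    Over a side of length \<open>T\<close> the constant part contributes \<open>T * B\<close>, and
    the power of \<open>G\<close> at most 1 by the choice of \<open>r\<close>.\<close>
  have vertical: "norm (K (Complex r T) - K (Complex r 0)) \<le> (T * B + 1) / (r - x)\<^sup>2"
    if "0 \<le> T" "\<Phi> T r \<le> 1" "r \<noteq> x" for T r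
  proof -
    have cont: "continuous_on {0..T} (\<lambda>s. k (Complex r s))"
      by (intro continuous_on_compose2[OF cont_k] continuous_intros) (use inS that in auto)
    have "has_bochner_integral lborel (\<lambda>s. indicator {0..T} s *\<^sub>R (\<i> * k (Complex r s))) (K (Complex r T) - K (Complex r 0))"
    proof (intro has_bochner_integral_FTC_Icc)
      fix s assume s: "0 \<le> s" "s \<le> T"
      have "((\<lambda>s. K (Complex r s)) has_vector_derivative \<i> * k (Complex r s)) (at s)"
        using that s inS by (intro field_vector_diff_chain_at[unfolded o_def, of _ \<i>] K)
          (auto simp: Complex_eq intro!: derivative_eq_intros)
      then show "((\<lambda>s. K (Complex r s)) has_vector_derivative \<i> * k (Complex r s)) (at s within {0..T})"
        by (auto intro: has_vector_derivative_at_within)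
    qed (use that cont in \<open>auto intro!: continuous_intros\<close>)
    then have "ennreal (norm (K (Complex r T) - K (Complex r 0))) \<le> (\<integral>\<^sup>+s. ennreal (norm (indicator {0..T} s *\<^sub>R (\<i> * k (Complex r s)))) \<partial>lborel)"
      by (rule has_bochner_integral_norm_bound)
    also have "\<dots> \<le> (\<integral>\<^sup>+s. ennreal (1 / (r - x)\<^sup>2) * (ennreal B * indicator {0..T} s + indicator {0..T} s * u r s) \<partial>lborel)"
    proof (intro nn_integral_mono)
      fix s
      show "ennreal (norm (indicator {0..T} s *\<^sub>R (\<i> * k (Complex r s)))) \<le> ennreal (1 / (r - x)\<^sup>2) * (ennreal B * indicator {0..T} s + indicator {0..T} s * u r s)"
      proof (cases "s \<in> {0..T}")
        case True
        have "(r - x)\<^sup>2 \<le> (norm (Complex r s - z))\<^sup>2"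
          by (simp add: z_def cmod_def)
        moreover have "norm (k (Complex r s)) \<le> (B + norm (G (Complex r s)) powr p) / (norm (Complex r s - z))\<^sup>2"
          using True that by (intro k_le) (auto simp: z_def)
        ultimately have "norm (k (Complex r s)) \<le> (B + norm (G (Complex r s)) powr p) / (r - x)\<^sup>2"
          using B that by (elim order_trans) (intro divide_left_mono mult_pos_pos; auto simp: z_def complex_eq_iff)
        then have "ennreal (norm (k (Complex r s))) \<le> ennreal (1 / (r - x)\<^sup>2 * (B + norm (G (Complex r s)) powr p))"
          by (intro ennreal_leI) simp
        also have "\<dots> = ennreal (1 / (r - x)\<^sup>2) * (ennreal B + ennreal (norm (G (Complex r s)) powr p))"
          using B by (subst ennreal_mult) auto
        finally show ?thesis
          using True by (simp add: norm_mult u)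
      qed auto
    qed
    also have "\<dots> = ennreal (1 / (r - x)\<^sup>2) * (ennreal B * ennreal T + \<Phi> T r)"
    proof -
      have "(\<integral>\<^sup>+s. ennreal B * indicator {0..T} s + indicator {0..T} s * u r s \<partial>lborel) = ennreal B * ennreal T + \<Phi> T r"
        unfolding \<Phi>_def using that by (subst nn_integral_add) (auto simp: nn_integral_cmult_indicator)
      then show ?thesis by (subst nn_integral_cmult) auto
    qed
    also have "\<dots> \<le> ennreal (1 / (r - x)\<^sup>2) * (ennreal B * ennreal T + 1)"
      using that by (intro mult_left_mono add_left_mono) auto
    also have "\<dots> = ennreal (1 / (r - x)\<^sup>2 * (B * T + 1))"
      using that B by (subst ennreal_mult) (auto simp: ennreal_mult)
    finally show ?thesis
      using that B by (subst (asm) ennreal_le_iff) (auto simp: mult.commute)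
  qed
  have int_k: "integrable lborel (\<lambda>t. k (Complex t 0))"
  proof (rule integrableI_bounded)
    show "(\<integral>\<^sup>+t. ennreal (norm (k (Complex t 0))) \<partial>lborel) < \<infinity>"
      using line[of 0 y] y by (auto intro: order_le_less_trans)
  qed (use measurable_k[of 0] in simp)
  define I where "I = (\<integral>t. k (Complex t 0) \<partial>lborel)"
  have lim: "((\<lambda>R. \<integral>t. indicator {-R..R} t *\<^sub>R k (Complex t 0) \<partial>lborel) \<longlongrightarrow> I) at_top"
    unfolding I_def
  proof (rule integral_dominated_convergence_at_top[where w="\<lambda>t. norm (k (Complex t 0))"])
    show "AE t in lborel. ((\<lambda>R. indicator {-R..R} t *\<^sub>R k (Complex t 0)) \<longlongrightarrow> k (Complex t 0)) at_top"
    proof (intro AE_I2 tendsto_eventually)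
      fix t
      show "\<forall>\<^sub>F R in at_top. indicator {-R..R} t *\<^sub>R k (Complex t 0) = k (Complex t 0)"
        using eventually_ge_at_top[of "\<bar>t\<bar>"] by eventually_elim (auto simp: indicator_def)
    qed
  qed (use int_k in \<open>auto split: split_indicator\<close>)
  have "I = 0"
  proof (rule ccontr)
    assume "I \<noteq> 0"
    \<comment> \<open>Four errors of at most \<open>e\<close> arise: the top side, two vertical
      sides, and the truncation of \<open>I\<close> to \<open>{-R..R}\<close>. A fifth of
      \<open>norm I\<close> therefore gives a contradiction. The height \<open>T\<close> is fixed
      before \<open>R\<close>, since the bound on the vertical sides grows with
      \<open>T\<close>.\<close>
    define e where "e = norm I / 5"
    have e: "0 < e" using \<open>I \<noteq> 0\<close> by (simp add: e_def)
    have "((\<lambda>d. pi * B / d + C / d\<^sup>2) \<longlongrightarrow> 0) at_top"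
      by real_asymp
    then have "\<forall>\<^sub>F d in at_top. pi * B / d + C / d\<^sup>2 < e \<and> 0 < d"
      using e by (intro eventually_conj eventually_gt_at_top) (auto dest: order_tendstoD(2)[of _ _ _ e])
    then obtain d where d: "pi * B / d + C / d\<^sup>2 < e" "0 < d"
      by (auto dest: eventually_happens)
    define T where "T = y + d"
    have T: "0 \<le> T" using y d by (simp add: T_def)
    have "((\<lambda>R. (T * B + 1) / (R - x)\<^sup>2) \<longlongrightarrow> 0) at_top" "((\<lambda>R. (T * B + 1) / (- R - x)\<^sup>2) \<longlongrightarrow> 0) at_top"
      by real_asymp+
    then have "\<forall>\<^sub>F R in at_top. (T * B + 1) / (R - x)\<^sup>2 < e \<and> (T * B + 1) / (- R - x)\<^sup>2 < e \<and> \<bar>x\<bar> < R \<and>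
        dist (\<integral>t. indicator {-R..R} t *\<^sub>R k (Complex t 0) \<partial>lborel) I < e"
      using e lim by (intro eventually_conj eventually_gt_at_top) (auto dest: order_tendstoD(2)[of _ _ _ e] tendstoD)
    then obtain N where N: "\<And>R. R \<ge> N \<Longrightarrow> (T * B + 1) / (R - x)\<^sup>2 < e \<and> (T * B + 1) / (- R - x)\<^sup>2 < e \<and> \<bar>x\<bar> < R \<and>
        dist (\<integral>t. indicator {-R..R} t *\<^sub>R k (Complex t 0) \<partial>lborel) I < e"
      by (auto simp: eventually_at_top_linorder)
    obtain R where R: "N \<le> R" "\<Phi> T R \<le> 1" "\<Phi> T (- R) \<le> 1"
      using exists_symmetric_pair_le_1[OF _ \<Phi>[OF T], of N] by auto
    have R0: "0 \<le> R" "R \<noteq> x" "- R \<noteq> x" using N[OF R(1)] by auto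
    have 1: "norm (K (Complex R T) - K (Complex R 0)) \<le> e" "norm (K (Complex (- R) T) - K (Complex (- R) 0)) \<le> e"
      using vertical[OF T R(2) R0(2)] vertical[OF T R(3) R0(3)] N[OF R(1)] by auto
    have "ennreal (norm (K (Complex R T) - K (Complex (- R) T))) \<le> (\<integral>\<^sup>+t. ennreal (norm (indicator {-R..R} t *\<^sub>R k (Complex t T))) \<partial>lborel)"
    proof (subst horizontal[symmetric, OF T R0(1)], rule integral_norm_bound_ennreal)
      show "integrable lborel (\<lambda>t. indicator {-R..R} t *\<^sub>R k (Complex t T))"
        using borel_integrable_compact[of "{-R..R}" "\<lambda>t. k (Complex t T)"] continuous_on_subset[OF cont_line[OF T]]
        by simp
    qed
    also have "\<dots> \<le> (\<integral>\<^sup>+t. ennreal (norm (k (Complex t T))) \<partial>lborel)"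
      by (intro nn_integral_mono) (auto split: split_indicator)
    also have "\<dots> \<le> ennreal (pi * B / d + C / d\<^sup>2)"
      using d T by (intro line) (auto simp: T_def)
    also have "\<dots> \<le> ennreal e"
      using d by (intro ennreal_leI) auto
    finally have 2: "norm (K (Complex R T) - K (Complex (- R) T)) \<le> e"
      using e by simp
    have 3: "norm ((K (Complex R 0) - K (Complex (- R) 0)) - I) < e"
      using N[OF R(1)] horizontal[of 0 R] R0 by (simp add: dist_norm)
    have "I = (K (Complex R T) - K (Complex (- R) T)) - (K (Complex R T) - K (Complex R 0)) + (K (Complex (- R) T) - K (Complex (- R) 0))
        - ((K (Complex R 0) - K (Complex (- R) 0)) - I)"
      by simp
    moreover have "norm (a - b + c - d) \<le> norm a + norm b + norm c + norm d" for a b c d :: complex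
      using norm_triangle_ineq4[of "a - b + c" d] norm_triangle_ineq[of "a - b" c] norm_triangle_ineq4[of a b] by linarith
    ultimately have "norm I \<le> e + e + e + e"
      using 1 2 3 by (smt (verit))
    then show False using e by (simp add: e_def)
  qed
  have k_real: "k (Complex t 0) = (pi / y) *\<^sub>R (poisson y (t - x) *\<^sub>R (G (Complex t 0) - G z))" for t
  proof -
    have "(Complex t 0 - z) * (Complex t 0 - cnj z) = of_real ((t - x)\<^sup>2 + y\<^sup>2)"
      by (simp add: z_def complex_eq_iff power2_eq_square)
    moreover have "Complex t 0 \<noteq> z"
      using y by (auto simp: z_def)
    ultimately have "k (Complex t 0) = (G (Complex t 0) - G z) / of_real ((t - x)\<^sup>2 + y\<^sup>2)"
      by (simp add: k_def)
    also have "\<dots> = (1 / ((t - x)\<^sup>2 + y\<^sup>2)) *\<^sub>R (G (Complex t 0) - G z)"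
      by (simp add: scaleR_conv_of_real)
    also have "1 / ((t - x)\<^sup>2 + y\<^sup>2) = pi / y * poisson y (t - x)"
      using y by (simp add: poisson_def)
    finally show ?thesis by simp
  qed
  have int1: "integrable lborel (\<lambda>t. poisson y (t - x) *\<^sub>R (G (Complex t 0) - G z))"
    using integrable_scaleR_right[OF int_k, of "y / pi"] y by (simp add: k_real)
  have P: "integrable lborel (\<lambda>t. poisson y (t - x))" "(\<integral>t. poisson y (t - x) \<partial>lborel) = 1"
    using nn_integral_poisson[OF y, of x] poisson_nonneg[OF y]
    by (auto intro!: integrableI_bounded simp: integral_eq_nn_integral)
  have "(\<integral>t. poisson y (t - x) *\<^sub>R G (Complex t 0) \<partial>lborel)
      = (\<integral>t. poisson y (t - x) *\<^sub>R (G (Complex t 0) - G z) + poisson y (t - x) *\<^sub>R G z \<partial>lborel)"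
    by (simp add: scaleR_diff_right)
  also have "\<dots> = (\<integral>t. poisson y (t - x) *\<^sub>R (G (Complex t 0) - G z) \<partial>lborel) + G z"
    using int1 P by (subst Bochner_Integration.integral_add) auto
  also have "(\<integral>t. poisson y (t - x) *\<^sub>R (G (Complex t 0) - G z) \<partial>lborel) = 0"
    using \<open>I = 0\<close> y unfolding I_def k_real integral_scaleR_right by simp
  finally show ?thesis by (simp add: z_def)
qed

subsection \<open>Hardy spaces\<close>

lemma nn_integral_lebesgue_eq_lborel: "(\<integral>\<^sup>+x. f x \<partial>lebesgue) = (\<integral>\<^sup>+x. f x \<partial>lborel)"
  by (rule nn_integral_completion)

lemma hardy_space_bound:
  assumes "F \<in> hardy_space p"
  obtains C where "0 \<le> C" "\<And>y. 0 < y \<Longrightarrow> (\<integral>\<^sup>+x. ennreal (norm (F (Complex x y)) powr p) \<partial>lborel) \<le> ennreal C"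
proof
  let ?S = "SUP y\<in>{0<..}. \<integral>\<^sup>+x. ennreal (norm (F (Complex x y)) powr p) \<partial>lebesgue"
  fix y :: real assume "0 < y"
  then have "(\<integral>\<^sup>+x. ennreal (norm (F (Complex x y)) powr p) \<partial>lborel) \<le> ?S"
    unfolding nn_integral_lebesgue_eq_lborel by (intro SUP_upper) auto
  also have "\<dots> = ennreal (enn2real ?S)"
    using assms by (simp add: hardy_space_def)
  finally show "(\<integral>\<^sup>+x. ennreal (norm (F (Complex x y)) powr p) \<partial>lborel) \<le> ennreal (enn2real ?S)" .
qed simp

lemma hardy_spaceI:
  assumes "F holomorphic_on upper_halfplane"
    and "\<And>y. 0 < y \<Longrightarrow> (\<integral>\<^sup>+x. ennreal (norm (F (Complex x y)) powr p) \<partial>lborel) \<le> ennreal C"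
  shows "F \<in> hardy_space p"
proof -
  have "(SUP y\<in>{0<..}. \<integral>\<^sup>+x. ennreal (norm (F (Complex x y)) powr p) \<partial>lebesgue) \<le> ennreal C"
    unfolding nn_integral_lebesgue_eq_lborel using assms(2) by (intro SUP_least) auto
  also have "\<dots> < \<infinity>" by simp
  finally show ?thesis
    using assms(1) by (simp add: hardy_space_def)
qed

text \<open>The vertical ray over \<open>x\<close> lies in every Stolz angle at \<open>x\<close>. A
  sequence of heights is used because Fatou's lemma and measurability of limits concern
  sequences.\<close>

lemma has_boundary_values_vertical:
  assumes "has_boundary_values F f"
  shows "AE x in lborel. (\<lambda>n. F (Complex x (inverse (real (Suc n))))) \<longlonglongrightarrow> f x"
proof -
  have "AE x in lebesgue. (\<lambda>n. F (Complex x (inverse (real (Suc n))))) \<longlonglongrightarrow> f x"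
    using assms unfolding has_boundary_values_def
  proof eventually_elim
    case (elim x)
    then have lim: "(F \<longlongrightarrow> f x) (at (complex_of_real x) within stolz_angle 1 x)"
      by auto
    have "(\<lambda>n. Complex x (inverse (real (Suc n)))) \<longlonglongrightarrow> Complex x 0"
      by (intro tendsto_Complex tendsto_const LIMSEQ_inverse_real_of_nat)
    moreover have "Complex x (inverse (real (Suc n))) \<in> stolz_angle 1 x" for n
      by (simp add: stolz_angle_def)
    ultimately have "filterlim (\<lambda>n. Complex x (inverse (real (Suc n)))) (at (complex_of_real x) within stolz_angle 1 x) sequentially"
      by (auto simp: filterlim_at complex_eq_iff complex_of_real_def intro!: always_eventually)
    then show ?case
      by (rule filterlim_compose[OF lim])
  qed
  then show ?thesis by (simp add: AE_completion_iff)
qed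

text \<open>Membership in the Hardy space gives only some finite bound; here it improves to the
  boundary norm. As \<open>poisson_representation\<close> needs holomorphy across the real line, it
  is applied to \<open>F\<close> shifted upwards by \<open>e n\<close>, and the shift is then
  removed.\<close>

lemma hardy_norm_le_boundary:
  assumes p: "1 < p" and F: "F \<in> hardy_space p" and bv: "has_boundary_values F f" and y: "0 < y"
  shows "(\<integral>\<^sup>+x. ennreal (norm (F (Complex x y)) powr p) \<partial>lborel) \<le> (\<integral>\<^sup>+x. ennreal (norm (f x) powr p) \<partial>lborel)"
proof -
  obtain C where C: "0 \<le> C" "\<And>y. 0 < y \<Longrightarrow> (\<integral>\<^sup>+x. ennreal (norm (F (Complex x y)) powr p) \<partial>lborel) \<le> ennreal C"
    by (rule hardy_space_bound[OF F]) blast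
  have hol: "F holomorphic_on {w. 0 < Im w}"
    using F by (simp add: hardy_space_def upper_halfplane_def)
  have F_line: "continuous_on UNIV (\<lambda>t. F (Complex t s))" if "0 < s" for s
    using that by (intro continuous_on_horizontal_line[of 0] holomorphic_on_imp_continuous_on hol)
  have F_measurable: "(\<lambda>t. F (Complex t s)) \<in> borel_measurable borel" if "0 < s" for s
    using F_line[OF that] by (rule borel_measurable_continuous_onI)
  define e where "e n = inverse (real (Suc n))" for n
  have e: "0 < e n" "e \<longlonglongrightarrow> 0" for n
    using LIMSEQ_inverse_real_of_nat by (auto simp: e_def[abs_def])
  define g where "g n x = F (Complex x (e n))" for n x
  have g [measurable]: "g n \<in> borel_measurable borel" for n
    using F_measurable[OF e(1)] by (simp add: g_def[abs_def])
  \<comment> \<open>A Borel representative of \<open>f\<close>: limits of Borel functions are Borel,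
    and the unspecified value of \<open>lim\<close> at points of divergence concerns a null
    set.\<close>
  define h where "h x = lim (\<lambda>n. g n x)" for x
  have h [measurable]: "h \<in> borel_measurable borel"
    unfolding h_def by measurable
  have lim_f: "AE x in lborel. (\<lambda>n. g n x) \<longlonglongrightarrow> f x"
    using has_boundary_values_vertical[OF bv] by (simp add: g_def e_def)
  have f_eq_h: "AE x in lborel. f x = h x"
    using lim_f by eventually_elim (simp add: h_def limI)
  have lim_h: "AE x in lborel. (\<lambda>n. g n x) \<longlonglongrightarrow> h x"
    using lim_f f_eq_h by eventually_elim simp
  have bound_g: "(\<integral>\<^sup>+x. ennreal (norm (g n x) powr p) \<partial>lborel) \<le> ennreal C" for n
    unfolding g_def by (rule C(2)[OF e(1)])
  have bound_h: "(\<integral>\<^sup>+x. ennreal (norm (h x) powr p) \<partial>lborel) \<le> ennreal C"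
  proof -
    have "(\<integral>\<^sup>+x. ennreal (norm (h x) powr p) \<partial>lborel) = (\<integral>\<^sup>+x. liminf (\<lambda>n. ennreal (norm (g n x) powr p)) \<partial>lborel)"
      using lim_h
    proof (intro nn_integral_cong_AE, eventually_elim)
      case (elim x)
      then have "(\<lambda>n. ennreal (norm (g n x) powr p)) \<longlonglongrightarrow> ennreal (norm (h x) powr p)"
        using p by (intro tendsto_ennrealI tendsto_powr' tendsto_norm tendsto_const) auto
      from lim_imp_Liminf[OF sequentially_bot this] show ?case by (rule sym)
    qed
    also have "\<dots> \<le> liminf (\<lambda>n. \<integral>\<^sup>+x. ennreal (norm (g n x) powr p) \<partial>lborel)"
      by (intro nn_integral_liminf) measurable
    also have "\<dots> \<le> ennreal C"
      by (intro Liminf_le sequentially_bot always_eventually allI bound_g)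
    finally show ?thesis .
  qed
  have pointwise: "ennreal (norm (F (Complex x y)) powr p) \<le> (\<integral>\<^sup>+t. ennreal (poisson y (t - x)) * ennreal (norm (h t) powr p) \<partial>lborel)" for x
  proof -
    define M where "M = density lborel (\<lambda>t. ennreal (poisson y (t - x)))"
    interpret M: prob_space M
      unfolding M_def using y by (rule prob_space_poisson)
    have [measurable_cong]: "sets M = sets borel"
      by (simp add: M_def)
    have eqM: "(\<integral>\<^sup>+t. ennreal (norm (k t) powr p) \<partial>M) = (\<integral>\<^sup>+t. ennreal (poisson y (t - x)) * ennreal (norm (k t) powr p) \<partial>lborel)"
      if [measurable]: "k \<in> borel_measurable borel" for k :: "real \<Rightarrow> complex"
      unfolding M_def by (subst nn_integral_density) auto
    have leM: "(\<integral>\<^sup>+t. ennreal (norm (k t) powr p) \<partial>M) \<le> ennreal (C / (pi * y))"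
      if [measurable]: "k \<in> borel_measurable borel" and "(\<integral>\<^sup>+t. ennreal (norm (k t) powr p) \<partial>lborel) \<le> ennreal C" for k :: "real \<Rightarrow> complex"
    proof -
      have "(\<integral>\<^sup>+t. ennreal (norm (k t) powr p) \<partial>M) \<le> (\<integral>\<^sup>+t. ennreal (1 / (pi * y)) * ennreal (norm (k t) powr p) \<partial>lborel)"
        unfolding eqM[OF that(1)] using poisson_le[OF y] by (intro nn_integral_mono mult_right_mono ennreal_leI) auto
      also have "\<dots> \<le> ennreal (1 / (pi * y)) * ennreal C"
        using that(2) by (simp add: nn_integral_cmult mult_left_mono)
      also have "\<dots> = ennreal (C / (pi * y))"
        using y C by (subst ennreal_mult[symmetric]) auto
      finally show ?thesis .
    qed
    have lint: "(\<integral>t. k t \<partial>M) = (\<integral>t. poisson y (t - x) *\<^sub>R k t \<partial>lborel)"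
      if [measurable]: "k \<in> borel_measurable borel" for k :: "real \<Rightarrow> complex"
      unfolding M_def using poisson_nonneg[OF y] by (subst integral_density) auto
    have eq: "(\<integral>t. g n t \<partial>M) = F (Complex x (y + e n))" for n
    proof -
      have *: "Complex a b + \<i> * of_real (e n) = Complex a (b + e n)" for a b
        by (simp add: complex_eq_iff)
      have "F (Complex x y + \<i> * of_real (e n)) = (\<integral>t. poisson y (t - x) *\<^sub>R F (Complex t 0 + \<i> * of_real (e n)) \<partial>lborel)"
      proof (rule poisson_representation[of "\<lambda>w. F (w + \<i> * of_real (e n))"])
        show "(\<lambda>w. F (w + \<i> * of_real (e n))) holomorphic_on {w. - e n < Im w}"
          by (intro holomorphic_on_compose_gen[OF _ hol, unfolded o_def] holomorphic_intros) auto
        show "(\<integral>\<^sup>+t. ennreal (norm (F (Complex t s + \<i> * of_real (e n))) powr p) \<partial>lborel) \<le> ennreal C" if "0 \<le> s" for s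
          unfolding * using that e(1)[of n] by (intro C(2)) auto
      qed (use e p C y in auto)
      then show ?thesis
        by (simp add: lint g * g_def[abs_def, symmetric] flip: g_def)
    qed
    \<comment> \<open>The same integrals equal \<open>F (Complex x (y + e n))\<close> and converge
      to \<open>F (Complex x y)\<close> by continuity. Comparing the limits gives the Poisson
      representation from boundary values.\<close>
    have "(\<lambda>n. \<integral>t. g n t \<partial>M) \<longlonglongrightarrow> (\<integral>t. h t \<partial>M)"
    proof (rule M.tendsto_integral_of_powr_bounded[where C="C / (pi * y)" and p=p])
      show "AE x in M. (\<lambda>n. g n x) \<longlonglongrightarrow> h x"
        unfolding M_def using lim_h by (subst AE_density) auto
    qed (use g h p leM bound_g bound_h in auto)
    moreover have "(\<lambda>n. \<integral>t. g n t \<partial>M) \<longlonglongrightarrow> F (Complex x y)"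
    proof -
      have "isCont F (Complex x y)"
        using hol y by (intro continuous_on_interior[OF holomorphic_on_imp_continuous_on[OF hol]])
          (simp add: interior_open open_halfspace_Im_gt)
      moreover have "(\<lambda>n. Complex x (y + e n)) \<longlonglongrightarrow> Complex x (y + 0)"
        by (intro tendsto_intros tendsto_Complex e)
      ultimately show ?thesis
        unfolding eq using isCont_tendsto_compose[of "Complex x y" F] by simp
    qed
    ultimately have "F (Complex x y) = (\<integral>t. h t \<partial>M)"
      by (rule LIMSEQ_unique[symmetric])
    moreover have "integrable M h"
      using leM[OF h bound_h] p h by (intro M.integrable_of_powr_integrable[of _ p]) (auto intro: order_le_less_trans)
    ultimately have "ennreal (norm (F (Complex x y)) powr p) \<le> (\<integral>\<^sup>+t. ennreal (norm (h t) powr p) \<partial>M)"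
      using M.norm_expectation_powr_le[of h p] p by simp
    then show ?thesis by (simp add: eqM h)
  qed
  have "(\<integral>\<^sup>+x. ennreal (norm (F (Complex x y)) powr p) \<partial>lborel)
      \<le> (\<integral>\<^sup>+x. (\<integral>\<^sup>+t. ennreal (poisson y (t - x)) * ennreal (norm (h t) powr p) \<partial>lborel) \<partial>lborel)"
    by (intro nn_integral_mono pointwise)
  also have "\<dots> = (\<integral>\<^sup>+t. (\<integral>\<^sup>+x. ennreal (poisson y (t - x)) * ennreal (norm (h t) powr p) \<partial>lborel) \<partial>lborel)"
    by (rule lborel_pair.Fubini') measurable
  also have "\<dots> = (\<integral>\<^sup>+t. ennreal (norm (h t) powr p) \<partial>lborel)"
  proof -
    have "(\<integral>\<^sup>+x. ennreal (poisson y (t - x)) \<partial>lborel) = 1" for t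
      using nn_integral_poisson[OF y, of t] by (subst poisson_minus_commute)
    then show ?thesis by (simp add: nn_integral_multc)
  qed
  also have "\<dots> = (\<integral>\<^sup>+x. ennreal (norm (f x) powr p) \<partial>lborel)"
    using f_eq_h by (intro nn_integral_cong_AE) auto
  finally show ?thesis .
qed

subsection \<open>Branches of the logarithm\<close>

lemma complex_of_real_at_infinity_at_bot: "filterlim complex_of_real at_infinity at_bot"
  unfolding filterlim_at_infinity_conv_norm_at_top
  by (simp add: filterlim_at_bot_mirror filterlim_abs_real)

text \<open>A general filter covers both ends of the real line, for the Cayley quotient as well as
  for the argument of \<open>M\<close>.\<close>

lemma moebius_tendsto_1:
  fixes a b :: complex
  assumes F: "filterlim complex_of_real at_infinity F"
  shows "((\<lambda>t. (complex_of_real t + a) / (complex_of_real t + b)) \<longlongrightarrow> 1) F"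
proof -
  have inf: "filterlim (\<lambda>t. complex_of_real t + b) at_infinity F"
    using tendsto_add_filterlim_at_infinity'[OF F tendsto_const] .
  then have "((\<lambda>t. 1 + (a - b) / (complex_of_real t + b)) \<longlongrightarrow> 1 + 0) F"
    by (intro tendsto_add tendsto_const tendsto_divide_0[OF tendsto_const])
  moreover have "\<forall>\<^sub>F t in F. 1 + (a - b) / (complex_of_real t + b) = (complex_of_real t + a) / (complex_of_real t + b)"
    using filterlim_at_infinity_imp_eventually_ne[OF inf, of 0]
    by eventually_elim (simp add: field_simps)
  ultimately show ?thesis
    by (simp add: tendsto_cong)
qed

text \<open>The values are integer multiples of 2 pi i, so distinct ones are more than 1 apart, and
  a continuous function with discrete range is constant on a connected set.\<close>

lemma exp_eq_1_imp_constant_on: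
  fixes f :: "'a::topological_space \<Rightarrow> complex"
  assumes "connected S" "continuous_on S f" and exp: "\<And>x. x \<in> S \<Longrightarrow> exp (f x) = 1"
  shows "f constant_on S"
proof (rule continuous_discrete_range_constant[OF assms(1,2)], intro exI conjI allI impI)
  show "(0::real) < 1" by simp
  fix x y assume xy: "x \<in> S" "y \<in> S \<and> f y \<noteq> f x"
  obtain m n :: int where mn: "Re (f x) = 0" "Re (f y) = 0" "Im (f x) = of_int (2 * m) * pi" "Im (f y) = of_int (2 * n) * pi"
    using exp[of x] exp[of y] xy by (auto simp: exp_eq_1)
  then have "m \<noteq> n" using xy by (auto simp: complex_eq_iff)
  then have "1 \<le> \<bar>real_of_int (n - m)\<bar>" by linarith
  then have "1 * 1 \<le> \<bar>real_of_int (n - m)\<bar> * (2 * pi)"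
    using pi_ge_two by (intro mult_mono) auto
  also have "\<dots> = \<bar>Im (f y - f x)\<bar>"
    unfolding minus_complex.sel mn
    by (subst abs_of_pos[of "2 * pi", symmetric], simp, subst abs_mult[symmetric]) (simp add: algebra_simps)
  also have "\<dots> \<le> norm (f y - f x)" by (rule abs_Im_le_cmod)
  finally show "1 \<le> norm (f y - f x)" by simp
qed

text \<open>A value \<open>t \<le> 0\<close> would give \<open>Im z + 1 = t * Im z \<le> 0\<close>.
  Hence the principal \<open>Ln\<close> of the quotient is continuous up to the punctured real line
  and can serve as reference branch.\<close>

lemma quotient_not_nonpos_Reals:
  assumes "0 \<le> Im z" "z \<noteq> complex_of_real c"
  shows "(z + \<i>) / (z - complex_of_real c) \<notin> \<real>\<^sub>\<le>\<^sub>0"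
proof
  assume "(z + \<i>) / (z - complex_of_real c) \<in> \<real>\<^sub>\<le>\<^sub>0"
  then obtain t where t: "(z + \<i>) / (z - complex_of_real c) = complex_of_real t" "t \<le> 0"
    by (rule nonpos_Reals_cases)
  then have "z + \<i> = complex_of_real t * (z - complex_of_real c)"
    using assms by (simp add: field_simps)
  from arg_cong[OF this, of Im] have "Im z + 1 = t * Im z" by simp
  then show False
    using mult_nonpos_nonneg[OF t(2) assms(1)] assms(1) by linarith
qed

text \<open>Star-shaped about \<open>c + i\<close>: a segment from there stays in the open
  half-plane until its endpoint, hence avoids \<open>c\<close>.\<close>

lemma connected_punctured_closed_halfplane:
  "connected ({z. 0 \<le> Im z} - {complex_of_real c})"
proof (rule starlike_imp_connected)
  show "starlike ({z. 0 \<le> Im z} - {complex_of_real c})"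
    unfolding starlike_def
  proof (intro bexI ballI subsetI)
    fix z w assume z: "z \<in> {z. 0 \<le> Im z} - {complex_of_real c}"
      and "w \<in> closed_segment (complex_of_real c + \<i>) z"
    then obtain u where u: "0 \<le> u" "u \<le> 1" "w = (1 - u) *\<^sub>R (complex_of_real c + \<i>) + u *\<^sub>R z"
      by (auto simp: in_segment)
    then have Im: "Im w = (1 - u) + u * Im z" by simp
    have "w = z" if "u = 1" using u that by simp
    moreover have "0 < Im w" if "u \<noteq> 1"
      unfolding Im using u that z by (intro add_pos_nonneg) auto
    ultimately show "w \<in> {z. 0 \<le> Im z} - {complex_of_real c}"
      using z by force
  qed (auto simp: complex_eq_iff)
qed

text \<open>Compared with the principal branch, every \<open>M\<close> is seen to have the same
  limit \<open>m\<close> at both ends of the real line, because the quotient tends to 1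
  there.\<close>

lemma quotient_log_branch_cases:
  assumes "quotient_log_branch c M"
  obtains m where "\<And>z. 0 \<le> Im z \<Longrightarrow> z \<noteq> complex_of_real c \<Longrightarrow> M z = m + Ln ((z + \<i>) / (z - complex_of_real c))"
proof -
  let ?D = "{z. 0 \<le> Im z} - {complex_of_real c}"
  let ?N = "\<lambda>z. Ln ((z + \<i>) / (z - complex_of_real c))"
  have "(\<lambda>z. M z - ?N z) constant_on ?D"
  proof (rule exp_eq_1_imp_constant_on[OF connected_punctured_closed_halfplane])
    show "continuous_on ?D (\<lambda>z. M z - ?N z)"
      using assms quotient_not_nonpos_Reals
      by (intro continuous_intros) (auto simp: quotient_log_branch_def)
    fix z assume z: "z \<in> ?D"
    then have "(z + \<i>) / (z - complex_of_real c) \<noteq> 0"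
      using quotient_not_nonpos_Reals[of z c] by auto
    moreover have "exp (M z) = (z + \<i>) / (z - complex_of_real c)"
      using assms z by (auto simp: quotient_log_branch_def)
    ultimately show "exp (M z - ?N z) = 1"
      by (simp add: exp_diff)
  qed
  then obtain m where "\<And>z. z \<in> ?D \<Longrightarrow> M z - ?N z = m"
    unfolding constant_on_def by blast
  then show thesis
    by (intro that[of m]) (auto simp: algebra_simps)
qed

lemma cayley_eq_iff: "cayley \<xi> = cayley c \<longleftrightarrow> \<xi> = c"
proof
  assume "cayley \<xi> = cayley c"
  then have "(complex_of_real \<xi> - \<i>) * (complex_of_real c + \<i>) = (complex_of_real c - \<i>) * (complex_of_real \<xi> + \<i>)"
    using real_plus_i_nonzero[of c] real_plus_i_nonzero[of \<xi>] by (simp add: cayley_def frac_eq_eq)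
  then show "\<xi> = c"
    by (simp add: complex_eq_iff algebra_simps)
qed simp

lemma cayley_continuous: "continuous_on A cayley"
  unfolding cayley_def using real_plus_i_nonzero by (intro continuous_intros) auto

text \<open>The Cayley transform maps the reals into the unit circle, which the cut meets only at
  \<open>cayley c\<close>. At both ends of the line it tends to 1, a point off the cut where
  \<open>L\<close> is normalised to 0.\<close>

lemma log_branch_cayley:
  assumes "log_branch c L"
  shows "continuous_on (- {c}) (\<lambda>\<xi>. L (cayley \<xi>))"
    and "\<xi> \<noteq> c \<Longrightarrow> exp (L (cayley \<xi>)) = cayley \<xi>"
    and "filterlim complex_of_real at_infinity F \<Longrightarrow> \<forall>\<^sub>F \<xi> in F. \<xi> \<noteq> c \<Longrightarrow> ((\<lambda>\<xi>. L (cayley \<xi>)) \<longlongrightarrow> 0) F"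
proof -
  obtain \<Gamma> where \<Gamma>: "\<Gamma> \<inter> sphere 0 1 = {cayley c}" "L holomorphic_on - \<Gamma>"
    "\<And>z. z \<in> - \<Gamma> \<Longrightarrow> exp (L z) = z" "L 1 = 0"
    using assms by (auto simp: log_branch_def)
  have not_in: "cayley \<xi> \<in> - \<Gamma>" if "\<xi> \<noteq> c" for \<xi>
  proof
    assume "cayley \<xi> \<in> \<Gamma>"
    then have "cayley \<xi> \<in> \<Gamma> \<inter> sphere 0 1" by (simp add: norm_cayley)
    then show False using that by (simp add: \<Gamma>(1) cayley_eq_iff)
  qed
  have cont: "continuous_on (- \<Gamma>) L"
    by (rule holomorphic_on_imp_continuous_on[OF \<Gamma>(2)])
  show "continuous_on (- {c}) (\<lambda>\<xi>. L (cayley \<xi>))"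
    by (intro continuous_on_compose2[OF cont cayley_continuous]) (use not_in in auto)
  show "exp (L (cayley \<xi>)) = cayley \<xi>" if "\<xi> \<noteq> c"
    using \<Gamma>(3) not_in[OF that] by blast
  show "((\<lambda>\<xi>. L (cayley \<xi>)) \<longlongrightarrow> 0) F"
    if F: "filterlim complex_of_real at_infinity F" and ev: "\<forall>\<^sub>F \<xi> in F. \<xi> \<noteq> c"
  proof -
    have "1 \<in> - \<Gamma>"
    proof
      assume "1 \<in> \<Gamma>"
      then have "1 \<in> \<Gamma> \<inter> sphere 0 1" by simp
      then show False using cayley_neq_1[of c] unfolding \<Gamma>(1) by simp
    qed
    moreover have "(cayley \<longlongrightarrow> 1) F"
      using moebius_tendsto_1[OF F, of "- \<i>" "\<i>"] by (simp add: cayley_def[abs_def])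
    moreover have "\<forall>\<^sub>F \<xi> in F. cayley \<xi> \<in> - \<Gamma>"
      using ev by eventually_elim (rule not_in)
    ultimately have "((\<lambda>\<xi>. L (cayley \<xi>)) \<longlongrightarrow> L 1) F"
      by (intro continuous_on_tendsto_compose[OF cont])
    then show ?thesis by (simp add: \<Gamma>(4))
  qed
qed

text \<open>A logarithm of a unimodular number is purely imaginary, and a real exponent keeps it
  so.\<close>

lemma norm_r_fun:
  assumes "log_branch c L" "\<xi> \<noteq> c"
  shows "norm (r_fun L (complex_of_real \<alpha>) \<xi>) = 1"
proof -
  have "norm (exp (L (cayley \<xi>))) = 1"
    using log_branch_cayley(2)[OF assms] by (simp add: norm_cayley)
  then show ?thesis by (simp add: r_fun_def)
qed

text \<open>
  Off \<open>c\<close>, \<open>L \<circ> cayley\<close> and \<open>cnj \<circ> M - M\<close> are logarithms of the same function; the limits at \<open>\<plusminus>\<infinity>\<close>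
  show that they differ by the same constant on both sides of \<open>c\<close>.
\<close>

lemma r_fun_mult_quotient_power:
  assumes L: "log_branch c L" and M: "quotient_log_branch c M"
  obtains \<kappa> where "norm \<kappa> = 1"
    "\<And>\<xi>. \<xi> \<noteq> c \<Longrightarrow> r_fun L (complex_of_real \<alpha>) \<xi> * quotient_power M (complex_of_real \<alpha>) \<xi> = \<kappa> * cnj (quotient_power M (complex_of_real \<alpha>) \<xi>)"
proof -
  obtain m where m: "\<And>z. 0 \<le> Im z \<Longrightarrow> z \<noteq> complex_of_real c \<Longrightarrow> M z = m + Ln ((z + \<i>) / (z - complex_of_real c))"
    by (rule quotient_log_branch_cases[OF M]) blast
  define E where "E \<xi> = L (cayley \<xi>) + M (complex_of_real \<xi>) - cnj (M (complex_of_real \<xi>))" for \<xi>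
  have M_cont: "continuous_on (- {c}) (\<lambda>\<xi>. M (complex_of_real \<xi>))"
  proof (rule continuous_on_compose2[where g=M])
    show "continuous_on ({z. 0 \<le> Im z} - {complex_of_real c}) M"
      using M by (simp add: quotient_log_branch_def)
  qed (auto intro: continuous_intros)
  have E_cont: "continuous_on (- {c}) E"
    unfolding E_def by (intro continuous_intros log_branch_cayley(1)[OF L] M_cont)
  have exp_E: "exp (E \<xi>) = 1" if "\<xi> \<noteq> c" for \<xi>
  proof -
    have eM: "exp (M (complex_of_real \<xi>)) = (complex_of_real \<xi> + \<i>) / (complex_of_real \<xi> - complex_of_real c)"
      using M that unfolding quotient_log_branch_def by auto
    have "exp (E \<xi>) = cayley \<xi> * exp (M (complex_of_real \<xi>)) / cnj (exp (M (complex_of_real \<xi>)))"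
      unfolding E_def using log_branch_cayley(2)[OF L that] by (simp add: exp_add exp_diff exp_cnj)
    moreover have "complex_of_real \<xi> - \<i> \<noteq> 0" "complex_of_real \<xi> + \<i> \<noteq> 0" "complex_of_real \<xi> - complex_of_real c \<noteq> 0"
      using that by (auto simp: complex_eq_iff)
    ultimately show ?thesis
      unfolding eM cayley_def by simp
  qed
  \<comment> \<open>\<open>A\<close> is one side of \<open>c\<close> and \<open>F\<close> its
    infinite end, where \<open>L\<close> contributes 0 and \<open>M\<close> tends to
    \<open>m\<close>; this determines the constant value of \<open>E\<close>.\<close>
  have E_const: "E \<xi> = m - cnj m"
    if "\<xi> \<in> A" and A: "connected A" "A \<subseteq> - {c}" and F: "F \<noteq> bot" "\<forall>\<^sub>F \<xi> in F. \<xi> \<in> A"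
      and inf: "filterlim complex_of_real at_infinity F" for \<xi> A F
  proof -
    have "E constant_on A"
      using A(2) by (intro exp_eq_1_imp_constant_on A(1) continuous_on_subset[OF E_cont] exp_E) auto
    then obtain a where a: "\<And>\<xi>. \<xi> \<in> A \<Longrightarrow> E \<xi> = a"
      unfolding constant_on_def by blast
    have neq: "\<forall>\<^sub>F \<xi> in F. \<xi> \<noteq> c"
      using F(2) A(2) by (auto elim!: eventually_mono)
    have "((\<lambda>\<xi>. Ln ((complex_of_real \<xi> + \<i>) / (complex_of_real \<xi> + (- complex_of_real c)))) \<longlongrightarrow> Ln 1) F"
      by (intro tendsto_Ln moebius_tendsto_1[OF inf]) auto
    then have "((\<lambda>\<xi>. m + Ln ((complex_of_real \<xi> + \<i>) / (complex_of_real \<xi> - complex_of_real c))) \<longlongrightarrow> m + 0) F"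
      by (intro tendsto_intros) simp
    moreover have "\<forall>\<^sub>F \<xi> in F. m + Ln ((complex_of_real \<xi> + \<i>) / (complex_of_real \<xi> - complex_of_real c)) = M (complex_of_real \<xi>)"
      using neq by eventually_elim (simp add: m)
    ultimately have "((\<lambda>\<xi>. M (complex_of_real \<xi>)) \<longlongrightarrow> m + 0) F"
      by (rule Lim_transform_eventually)
    then have "(E \<longlongrightarrow> 0 + (m + 0) - cnj (m + 0)) F"
      unfolding E_def by (intro tendsto_intros log_branch_cayley(3)[OF L inf neq])
    moreover have "(E \<longlongrightarrow> a) F"
      using F(2) a by (intro tendsto_eventually) (auto elim!: eventually_mono)
    ultimately show ?thesis
      using tendsto_unique[OF F(1)] a[OF that(1)] by force
  qed
  have E: "E \<xi> = m - cnj m" if "\<xi> \<noteq> c" for \<xi>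
  proof (cases "\<xi> < c")
    case True
    then show ?thesis
      by (intro E_const[of _ "{..<c}" at_bot] complex_of_real_at_infinity_at_bot) (auto intro: eventually_gt_at_bot)
  next
    case False
    then show ?thesis
      using that by (intro E_const[of _ "{c<..}" at_top] filterlim_of_real_at_infinity) (auto intro: eventually_gt_at_top)
  qed
  show thesis
  \<comment> \<open>\<open>m - cnj m\<close> is purely imaginary, so this constant is unimodular for
    real \<open>\<alpha>\<close>.\<close>
  proof (rule that[of "exp (complex_of_real \<alpha> * (m - cnj m))"])
    show "norm (exp (complex_of_real \<alpha> * (m - cnj m))) = 1"
      by simp
    fix \<xi> assume "\<xi> \<noteq> c"
    then have "L (cayley \<xi>) + M (complex_of_real \<xi>) = (m - cnj m) + cnj (M (complex_of_real \<xi>))"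
      using E[of \<xi>] by (simp add: E_def algebra_simps)
    from arg_cong[OF this, of "\<lambda>w. exp (complex_of_real \<alpha> * w)"]
    show "r_fun L (complex_of_real \<alpha>) \<xi> * quotient_power M (complex_of_real \<alpha>) \<xi> = exp (complex_of_real \<alpha> * (m - cnj m)) * cnj (quotient_power M (complex_of_real \<alpha>) \<xi>)"
      by (simp add: r_fun_def quotient_power_def exp_cnj exp_add distrib_left)
  qed
qed

subsection \<open>Multiplication in Hardy spaces\<close>

lemma Lp_cong_AE:
  assumes "f \<in> Lp p" "g \<in> borel_measurable lebesgue" "AE x in lebesgue. norm (g x) = norm (f x)"
  shows "g \<in> Lp p"
proof -
  have "integrable lebesgue (\<lambda>x. norm (g x) powr p) \<longleftrightarrow> integrable lebesgue (\<lambda>x. norm (f x) powr p)"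
    using assms by (intro integrable_cong_AE) (auto simp: Lp_def elim!: eventually_mono)
  then show ?thesis using assms by (simp add: Lp_def)
qed

lemma Lp_mult_bounded:
  assumes f: "f \<in> Lp p" and b: "b \<in> borel_measurable lebesgue" "AE x in lebesgue. norm (b x) \<le> K" and p: "0 \<le> p"
  shows "(\<lambda>x. b x * f x) \<in> Lp p"
proof -
  have [measurable]: "f \<in> borel_measurable lebesgue" "b \<in> borel_measurable lebesgue"
    using f b by (auto simp: Lp_def)
  have "integrable lebesgue (\<lambda>x. norm (b x * f x) powr p)"
  proof (rule Bochner_Integration.integrable_bound)
    show "integrable lebesgue (\<lambda>x. K powr p * norm (f x) powr p)"
      using f by (simp add: Lp_def)
    show "AE x in lebesgue. norm (norm (b x * f x) powr p) \<le> norm (K powr p * norm (f x) powr p)"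
      using b(2)
    proof eventually_elim
      case (elim x)
      then have "norm (b x) powr p \<le> K powr p"
        using p by (intro powr_mono2) auto
      then show ?case
        by (simp add: norm_mult powr_mult mult_right_mono)
    qed
  qed measurable
  then show ?thesis by (simp add: Lp_def)
qed

lemma Lp_nn_integral:
  assumes "f \<in> Lp p"
  obtains C where "0 \<le> C" "(\<integral>\<^sup>+x. ennreal (norm (f x) powr p) \<partial>lborel) = ennreal C"
proof
  have "integrable lebesgue (\<lambda>x. norm (f x) powr p)"
    using assms by (simp add: Lp_def)
  from nn_integral_eq_integral[OF this]
  show "(\<integral>\<^sup>+x. ennreal (norm (f x) powr p) \<partial>lborel) = ennreal (\<integral>x. norm (f x) powr p \<partial>lebesgue)"
    by (simp add: nn_integral_lebesgue_eq_lborel)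
qed simp

lemma cnj_borel_measurable: "(\<lambda>x. cnj (f x)) \<in> borel_measurable M" if "f \<in> borel_measurable M"
  by (rule measurable_compose[OF that borel_measurable_continuous_onI]) (intro continuous_intros)

lemma Lp_cnj: "(\<lambda>x. cnj (f x)) \<in> Lp p" if "f \<in> Lp p"
  using that by (auto simp: Lp_def cnj_borel_measurable)

lemma Hp_minus_iff: "f \<in> Hp_minus p \<longleftrightarrow> (\<lambda>x. cnj (f x)) \<in> Hp_plus p"
proof
  assume "(\<lambda>x. cnj (f x)) \<in> Hp_plus p"
  then have "(\<lambda>x. cnj (cnj (f x))) \<in> Hp_minus p"
    unfolding Hp_minus_def mem_Collect_eq by (intro exI[of _ "\<lambda>x. cnj (f x)"] conjI refl)
  then show "f \<in> Hp_minus p" by simp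
qed (auto simp: Hp_minus_def)

lemma Hp_plus_cong_AE:
  assumes "f \<in> Hp_plus p" "g \<in> borel_measurable lebesgue" "AE x in lebesgue. g x = f x"
  shows "g \<in> Hp_plus p"
proof -
  obtain F where F: "f \<in> Lp p" "F \<in> hardy_space p" "has_boundary_values F f"
    using assms(1) by (auto simp: Hp_plus_def)
  have "g \<in> Lp p"
    using F(1) assms(2) by (rule Lp_cong_AE) (use assms(3) in auto)
  moreover have "has_boundary_values F g"
    using F(3) assms(3) unfolding has_boundary_values_def by eventually_elim simp
  ultimately show ?thesis using F(2) by (auto simp: Hp_plus_def)
qed

lemma hardy_space_mult_bounded:
  assumes F: "F \<in> hardy_space p" and B: "B holomorphic_on upper_halfplane"
    and K: "\<And>z. z \<in> upper_halfplane \<Longrightarrow> norm (B z) \<le> K" and p: "0 \<le> p"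
  shows "(\<lambda>z. B z * F z) \<in> hardy_space p"
proof -
  obtain C where C: "0 \<le> C" "\<And>y. 0 < y \<Longrightarrow> (\<integral>\<^sup>+x. ennreal (norm (F (Complex x y)) powr p) \<partial>lborel) \<le> ennreal C"
    by (rule hardy_space_bound[OF F]) blast
  have hol: "F holomorphic_on upper_halfplane"
    using F by (simp add: hardy_space_def)
  show ?thesis
  proof (rule hardy_spaceI)
    show "(\<lambda>z. B z * F z) holomorphic_on upper_halfplane"
      by (intro holomorphic_intros B hol)
    fix y :: real assume y: "0 < y"
    have [measurable]: "(\<lambda>x. F (Complex x y)) \<in> borel_measurable borel"
      using y by (intro borel_measurable_continuous_onI continuous_on_horizontal_line[of 0])
        (auto intro: holomorphic_on_imp_continuous_on[OF hol[unfolded upper_halfplane_def]])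
    have "(\<integral>\<^sup>+x. ennreal (norm (B (Complex x y) * F (Complex x y)) powr p) \<partial>lborel)
      \<le> (\<integral>\<^sup>+x. ennreal (K powr p) * ennreal (norm (F (Complex x y)) powr p) \<partial>lborel)"
    proof (intro nn_integral_mono)
      fix x
      have "norm (B (Complex x y)) powr p \<le> K powr p"
        using K[of "Complex x y"] y p by (intro powr_mono2) (auto simp: upper_halfplane_def)
      then show "ennreal (norm (B (Complex x y) * F (Complex x y)) powr p) \<le> ennreal (K powr p) * ennreal (norm (F (Complex x y)) powr p)"
        by (subst ennreal_mult[symmetric]) (auto simp: norm_mult powr_mult intro!: ennreal_leI mult_right_mono)
    qed
    also have "\<dots> \<le> ennreal (K powr p) * ennreal C"
      using C(2)[OF y] by (simp add: nn_integral_cmult mult_left_mono)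
    also have "\<dots> = ennreal (K powr p * C)"
      using C by (simp add: ennreal_mult)
    finally show "(\<integral>\<^sup>+x. ennreal (norm (B (Complex x y) * F (Complex x y)) powr p) \<partial>lborel) \<le> ennreal (K powr p * C)" .
  qed
qed

lemma has_boundary_values_mult:
  assumes "has_boundary_values F f" "has_boundary_values B b"
  shows "has_boundary_values (\<lambda>z. B z * F z) (\<lambda>x. b x * f x)"
  using assms unfolding has_boundary_values_def
  by eventually_elim (auto intro!: tendsto_mult)

lemma Hp_plus_mult_bounded:
  assumes f: "f \<in> Hp_plus p" and B: "B holomorphic_on upper_halfplane"
    and K: "\<And>z. z \<in> upper_halfplane \<Longrightarrow> norm (B z) \<le> K" and p: "0 \<le> p"
    and bv: "has_boundary_values B b" and b: "b \<in> borel_measurable lebesgue" "AE x in lebesgue. norm (b x) \<le> K"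
  shows "(\<lambda>x. b x * f x) \<in> Hp_plus p"
proof -
  obtain F where F: "f \<in> Lp p" "F \<in> hardy_space p" "has_boundary_values F f"
    using f by (auto simp: Hp_plus_def)
  show ?thesis
    using Lp_mult_bounded[OF F(1) b p] hardy_space_mult_bounded[OF F(2) B K p] has_boundary_values_mult[OF F(3) bv]
    by (auto simp: Hp_plus_def)
qed

lemma Hp_plus_cmult:
  assumes "f \<in> Hp_plus p" "0 \<le> p"
  shows "(\<lambda>x. a * f x) \<in> Hp_plus p"
  by (rule Hp_plus_mult_bounded[where B="\<lambda>_. a" and K="norm a"])
    (use assms in \<open>auto simp: has_boundary_values_def\<close>)

lemma AE_lebesgue_neq: "AE x in lebesgue. x \<noteq> (c::real)"
  using AE_lborel_singleton[of c] by (simp add: AE_completion_iff)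

subsection \<open>The branch power as a multiplier\<close>

context
  fixes c :: real and M :: "complex \<Rightarrow> complex"
  assumes M: "quotient_log_branch c M"
begin

lemma quotient_log_branch_tendsto:
  assumes "x \<noteq> c"
  shows "(M \<longlongrightarrow> M (complex_of_real x)) (at (complex_of_real x) within stolz_angle a x)"
proof -
  have "continuous_on ({z. 0 \<le> Im z} - {complex_of_real c}) M"
    using M by (simp add: quotient_log_branch_def)
  then have "(M \<longlongrightarrow> M (complex_of_real x)) (at (complex_of_real x) within {z. 0 \<le> Im z} - {complex_of_real c})"
    using assms by (simp add: continuous_on_def)
  then show ?thesis
    by (rule tendsto_within_subset) (auto simp: stolz_angle_def)
qed

lemma exp_quotient_log_branch_boundary_values:
  "has_boundary_values (\<lambda>z. exp (a * M z)) (quotient_power M a)"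
  using AE_lebesgue_neq[of c] unfolding has_boundary_values_def quotient_power_def
  by eventually_elim (intro allI impI tendsto_intros quotient_log_branch_tendsto)

lemma quotient_power_measurable: "quotient_power M a \<in> borel_measurable lebesgue"
proof -
  have "continuous_on (- {c}) (\<lambda>x. M (complex_of_real x))"
  proof (rule continuous_on_compose2[where g=M])
    show "continuous_on ({z. 0 \<le> Im z} - {complex_of_real c}) M"
      using M by (simp add: quotient_log_branch_def)
  qed (auto intro: continuous_intros)
  then have "continuous_on (UNIV - {c}) (quotient_power M a)"
    unfolding quotient_power_def Compl_eq_Diff_UNIV by (intro continuous_intros)
  then have "quotient_power M a \<in> borel_measurable borel"
    by (intro borel_measurable_continuous_countable_exceptions[of "{c}"]) (auto simp: Compl_eq_Diff_UNIV)
  then show ?thesis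
    by (intro measurable_completion) simp
qed

text \<open>All branches share the same real part, the logarithm of the modulus of the quotient;
  with a real exponent the modulus of the power does not depend on the branch.\<close>

lemma norm_exp_quotient_log_branch:
  fixes \<alpha> :: real
  assumes "0 \<le> Im z" "z \<noteq> complex_of_real c"
  shows "norm (exp (complex_of_real \<alpha> * M z)) = (norm (z + \<i>) / norm (z - complex_of_real c)) powr \<alpha>"
proof -
  have "exp (Re (M z)) = norm (z + \<i>) / norm (z - complex_of_real c)"
    using M assms by (metis (no_types, lifting) DiffI empty_iff insert_iff mem_Collect_eq norm_divide norm_exp_eq_Re quotient_log_branch_def)
  then have "norm (z + \<i>) / norm (z - complex_of_real c) = exp (Re (M z))" ..
  then show ?thesis
    by (simp add: exp_powr_real mult.commute)
qed

lemma Hp_plus_divide_quotient_power: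
  fixes \<alpha> :: real
  assumes f: "f \<in> Hp_plus p" and p: "0 \<le> p" and \<alpha>: "0 \<le> \<alpha>"
  shows "(\<lambda>x. f x / quotient_power M \<alpha> x) \<in> Hp_plus p"
proof -
  \<comment> \<open>From \<open>norm (z - c) \<le> norm (z + \<i>) + norm (c + \<i>)\<close> and
    \<open>1 \<le> norm (z + \<i>)\<close> in the closed upper half-plane.\<close>
  define K where "K = (1 + norm (complex_of_real c + \<i>)) powr \<alpha>"
  have le: "norm (exp (complex_of_real (- \<alpha>) * M z)) \<le> K" if z: "0 \<le> Im z" "z \<noteq> complex_of_real c" for z
  proof -
    have "1 \<le> \<bar>Im (z + \<i>)\<bar>"
      using z by simp
    then have 1: "1 \<le> norm (z + \<i>)"
      using abs_Im_le_cmod order_trans by blast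
    have "norm (z - complex_of_real c) \<le> norm (z + \<i>) + norm (complex_of_real c + \<i>)"
      using norm_triangle_ineq4[of "z + \<i>" "complex_of_real c + \<i>"] by simp
    also have "\<dots> \<le> norm (z + \<i>) + norm (z + \<i>) * norm (complex_of_real c + \<i>)"
      using mult_right_mono[OF 1 norm_ge_zero[of "complex_of_real c + \<i>"]] by simp
    finally have "norm (z - complex_of_real c) / norm (z + \<i>) \<le> 1 + norm (complex_of_real c + \<i>)"
      using 1 by (simp add: divide_le_eq algebra_simps)
    then have "(norm (z - complex_of_real c) / norm (z + \<i>)) powr \<alpha> \<le> K"
      unfolding K_def using \<alpha> by (intro powr_mono2) auto
    then show ?thesis
      unfolding norm_exp_quotient_log_branch[OF z] using 1 by (simp add: powr_minus powr_divide)
  qed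
  have "(\<lambda>x. quotient_power M (complex_of_real (- \<alpha>)) x * f x) \<in> Hp_plus p"
  proof (rule Hp_plus_mult_bounded[OF f _ _ p exp_quotient_log_branch_boundary_values quotient_power_measurable])
    show "(\<lambda>z. exp (complex_of_real (- \<alpha>) * M z)) holomorphic_on upper_halfplane"
      using M by (intro holomorphic_intros) (simp add: quotient_log_branch_def)
    show "norm (exp (complex_of_real (- \<alpha>) * M z)) \<le> K" if "z \<in> upper_halfplane" for z
      using that by (intro le) (auto simp: upper_halfplane_def)
    show "AE x in lebesgue. norm (quotient_power M (complex_of_real (- \<alpha>)) x) \<le> K"
      using AE_lebesgue_neq[of c] unfolding quotient_power_def by eventually_elim (rule le; simp)
  qed
  then show ?thesis
    by (simp add: quotient_power_def exp_minus field_simps)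
qed

text \<open>
  The unbounded factor \<open>Q(z) = exp (\<alpha> M(z))\<close> is approximated by its bounded translates
  \<open>Q(z + \<i>\<epsilon>)\<close>, which on the real line are dominated by \<open>(1 + \<epsilon>)\<^sup>\<alpha> |Q|\<close>.
\<close>

lemma Hp_plus_mult_quotient_power:
  fixes \<alpha> :: real
  assumes p: "1 < p" and \<alpha>: "0 \<le> \<alpha>" and h: "h \<in> Hp_plus p" and Lp: "(\<lambda>x. quotient_power M \<alpha> x * h x) \<in> Lp p"
  shows "(\<lambda>x. quotient_power M \<alpha> x * h x) \<in> Hp_plus p"
proof -
  obtain H where H: "H \<in> hardy_space p" "has_boundary_values H h"
    using h by (auto simp: Hp_plus_def)
  define Q where "Q z = exp (complex_of_real \<alpha> * M z)" for z
  have M_hol: "M holomorphic_on upper_halfplane"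
    using M by (simp add: quotient_log_branch_def)
  have Q_hol: "Q holomorphic_on upper_halfplane"
    unfolding Q_def by (intro holomorphic_intros M_hol)
  have Q_cont: "isCont Q z" if "z \<in> upper_halfplane" for z
    using that open_halfspace_Im_gt[of 0] holomorphic_on_imp_continuous_on[OF Q_hol]
    by (intro continuous_on_interior) (auto simp: upper_halfplane_def interior_open)
  have H_hol: "H holomorphic_on upper_halfplane"
    using H(1) by (simp add: hardy_space_def)
  obtain C where C: "0 \<le> C" "(\<integral>\<^sup>+x. ennreal (norm (quotient_power M \<alpha> x * h x) powr p) \<partial>lborel) = ennreal C"
    using Lp_nn_integral[OF Lp] by blast
  \<comment> \<open>The bound does not depend on \<open>y\<close> and stays bounded as
    \<open>e\<close> tends to 0, because it rests on the boundary integral \<open>C\<close> and not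
    on the supremum of the translated factor.\<close>
  have translate: "(\<integral>\<^sup>+x. ennreal (norm (Q (Complex x (y + e)) * H (Complex x y)) powr p) \<partial>lborel) \<le> ennreal (((1 + e) powr \<alpha>) powr p * C)"
    if e: "0 < e" and y: "0 < y" for e y
  proof -
    define Qe where "Qe z = Q (z + \<i> * complex_of_real e)" for z
    have shift: "z + \<i> * complex_of_real e \<in> upper_halfplane" if "0 \<le> Im z" for z
      using that e by (simp add: upper_halfplane_def)
    \<comment> \<open>This constant blows up as \<open>e\<close> tends to 0; it only serves to place
      \<open>Qe * H\<close> in the Hardy space, so that the boundary inequality applies.\<close>
    have bound: "norm (Qe z) \<le> (1 + norm (complex_of_real c + \<i>) / e) powr \<alpha>" if "z \<in> upper_halfplane" for z
    proof -
      let ?w = "z + \<i> * complex_of_real e"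
      have Im: "e < Im (?w - complex_of_real c)"
        using that by (simp add: upper_halfplane_def)
      then have ge: "e \<le> norm (?w - complex_of_real c)"
        using abs_Im_le_cmod[of "?w - complex_of_real c"] by linarith
      have ratio: "a / d \<le> 1 + b / d" if "a \<le> d + b" "e \<le> d" for a b d :: real
        using that e by (simp add: field_simps)
      have "norm (?w + \<i>) / norm (?w - complex_of_real c) \<le> 1 + norm (complex_of_real c + \<i>) / norm (?w - complex_of_real c)"
        using norm_triangle_ineq[of "?w - complex_of_real c" "complex_of_real c + \<i>"]
        by (intro ratio ge) (simp add: algebra_simps)
      also have "\<dots> \<le> 1 + norm (complex_of_real c + \<i>) / e"
        using ge e by (intro add_left_mono divide_left_mono mult_pos_pos) auto
      finally have "(norm (?w + \<i>) / norm (?w - complex_of_real c)) powr \<alpha> \<le> (1 + norm (complex_of_real c + \<i>) / e) powr \<alpha>"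
        using \<alpha> by (intro powr_mono2) auto
      moreover have "0 \<le> Im ?w" "?w \<noteq> complex_of_real c"
        using that e by (auto simp: upper_halfplane_def complex_eq_iff)
      ultimately show ?thesis
        unfolding Qe_def Q_def by (subst norm_exp_quotient_log_branch) auto
    qed
    have Qe_hol: "Qe holomorphic_on upper_halfplane"
      unfolding Qe_def using e
      by (intro holomorphic_on_compose_gen[OF _ Q_hol, unfolded o_def] holomorphic_intros) (auto simp: upper_halfplane_def)
    have "(\<lambda>z. Qe z * H z) \<in> hardy_space p"
      using p by (intro hardy_space_mult_bounded[OF H(1) Qe_hol bound]) auto
    moreover have "has_boundary_values (\<lambda>z. Qe z * H z) (\<lambda>x. Qe (complex_of_real x) * h x)"
    proof (intro has_boundary_values_mult H(2))
      have "isCont Qe (complex_of_real x)" for x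
        unfolding Qe_def
      proof (rule isCont_o2[where g=Q])
        show "isCont Q (complex_of_real x + \<i> * complex_of_real e)"
          by (rule Q_cont[OF shift]) simp
      qed (intro continuous_intros)
      then show "has_boundary_values Qe (\<lambda>x. Qe (complex_of_real x))"
        unfolding has_boundary_values_def isCont_def by (auto intro: tendsto_within_subset)
    qed
    ultimately have "(\<integral>\<^sup>+x. ennreal (norm (Qe (Complex x y) * H (Complex x y)) powr p) \<partial>lborel)
      \<le> (\<integral>\<^sup>+x. ennreal (norm (Qe (complex_of_real x) * h x) powr p) \<partial>lborel)"
      by (rule hardy_norm_le_boundary[OF p _ _ y])
    also have "\<dots> = (\<integral>\<^sup>+x. ennreal (norm (Qe (complex_of_real x) * h x) powr p) \<partial>lebesgue)"
      by (simp add: nn_integral_lebesgue_eq_lborel)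
    also have "\<dots> \<le> (\<integral>\<^sup>+x. ennreal (((1 + e) powr \<alpha>) powr p) * ennreal (norm (quotient_power M \<alpha> x * h x) powr p) \<partial>lebesgue)"
    proof (intro nn_integral_mono_AE)
      \<comment> \<open>Moving up by \<open>e\<close> takes the point farther from \<open>c\<close>,
        and increases \<open>norm (x + \<i>)\<close>, which is at least 1, by at most
        \<open>e\<close>, hence by a factor of at most \<open>1 + e\<close>.\<close>
      have "norm (Qe (complex_of_real x)) \<le> (1 + e) powr \<alpha> * norm (quotient_power M \<alpha> x)" if x: "x \<noteq> c" for x
      proof -
        let ?w = "complex_of_real x + \<i> * complex_of_real e"
        have w: "0 \<le> Im ?w" "?w \<noteq> complex_of_real c"
          using e by (auto simp: complex_eq_iff)
        have num: "norm (?w + \<i>) \<le> (1 + e) * norm (complex_of_real x + \<i>)"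
        proof -
          have "norm (?w + \<i>) \<le> norm (complex_of_real x + \<i>) + e"
            using norm_triangle_ineq[of "complex_of_real x + \<i>" "\<i> * complex_of_real e"] e
            by (simp add: norm_mult algebra_simps)
          moreover have "1 \<le> norm (complex_of_real x + \<i>)"
            using abs_Im_le_cmod[of "complex_of_real x + \<i>"] by simp
          then have "e \<le> e * norm (complex_of_real x + \<i>)"
            using e by simp
          ultimately show ?thesis by (simp add: algebra_simps)
        qed
        have den: "norm (complex_of_real x - complex_of_real c) \<le> norm (?w - complex_of_real c)"
          using abs_Re_le_cmod[of "?w - complex_of_real c"] by (simp flip: of_real_diff)
        have "norm (?w + \<i>) / norm (?w - complex_of_real c) \<le> (1 + e) * norm (complex_of_real x + \<i>) / norm (complex_of_real x - complex_of_real c)"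
          using num den x e by (intro frac_le) auto
        then have "(norm (?w + \<i>) / norm (?w - complex_of_real c)) powr \<alpha> \<le> ((1 + e) * (norm (complex_of_real x + \<i>) / norm (complex_of_real x - complex_of_real c))) powr \<alpha>"
          using \<alpha> by (intro powr_mono2) auto
        also have "\<dots> = (1 + e) powr \<alpha> * (norm (complex_of_real x + \<i>) / norm (complex_of_real x - complex_of_real c)) powr \<alpha>"
          using e by (subst powr_mult) auto
        finally show ?thesis
          unfolding Qe_def Q_def quotient_power_def norm_exp_quotient_log_branch[OF w]
          using x by (subst norm_exp_quotient_log_branch) auto
      qed
      note Qe_le = this
      show "AE x in lebesgue. ennreal (norm (Qe (complex_of_real x) * h x) powr p)
          \<le> ennreal (((1 + e) powr \<alpha>) powr p) * ennreal (norm (quotient_power M \<alpha> x * h x) powr p)"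
        using AE_lebesgue_neq[of c]
      proof eventually_elim
        case (elim x)
        have "norm (Qe (complex_of_real x) * h x) \<le> (1 + e) powr \<alpha> * norm (quotient_power M \<alpha> x * h x)"
          using mult_right_mono[OF Qe_le[OF elim] norm_ge_zero[of "h x"]] by (simp add: norm_mult mult.assoc)
        then have "norm (Qe (complex_of_real x) * h x) powr p \<le> ((1 + e) powr \<alpha> * norm (quotient_power M \<alpha> x * h x)) powr p"
          using p by (intro powr_mono2) auto
        then show ?case
          by (subst ennreal_mult[symmetric]) (auto simp: powr_mult intro!: ennreal_leI)
      qed
    qed
    also have "\<dots> = ennreal (((1 + e) powr \<alpha>) powr p) * ennreal C"
      using Lp by (subst nn_integral_cmult) (auto simp: Lp_def nn_integral_lebesgue_eq_lborel C(2))
    also have "\<dots> = ennreal (((1 + e) powr \<alpha>) powr p * C)"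
      using C by (simp add: ennreal_mult)
    finally have "(\<integral>\<^sup>+x. ennreal (norm (Qe (Complex x y) * H (Complex x y)) powr p) \<partial>lborel) \<le> ennreal (((1 + e) powr \<alpha>) powr p * C)" .
    moreover have "Qe (Complex x y) = Q (Complex x (y + e))" for x
      unfolding Qe_def by (rule arg_cong[of _ _ Q]) (simp add: complex_eq_iff)
    ultimately show ?thesis by simp
  qed
  have "(\<lambda>z. Q z * H z) \<in> hardy_space p"
  proof (rule hardy_spaceI)
    show "(\<lambda>z. Q z * H z) holomorphic_on upper_halfplane"
      by (intro holomorphic_intros Q_hol H_hol)
    fix y :: real assume y: "0 < y"
    define e where "e n = inverse (real (Suc n))" for n
    have e: "0 < e n" "e \<longlonglongrightarrow> 0" for n
      using LIMSEQ_inverse_real_of_nat by (auto simp: e_def[abs_def])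
    have line_measurable: "(\<lambda>x. G (Complex x s)) \<in> borel_measurable borel"
      if "G holomorphic_on upper_halfplane" "0 < s" for G s
      using that by (intro borel_measurable_continuous_onI continuous_on_horizontal_line[of 0])
        (auto intro: holomorphic_on_imp_continuous_on simp: upper_halfplane_def)
    have [measurable]: "(\<lambda>x. Q (Complex x (y + e n))) \<in> borel_measurable borel"
      "(\<lambda>x. H (Complex x y)) \<in> borel_measurable borel" for n
      using y e(1)[of n] by (auto intro!: line_measurable Q_hol H_hol)
    have "(\<integral>\<^sup>+x. ennreal (norm (Q (Complex x y) * H (Complex x y)) powr p) \<partial>lborel)
        = (\<integral>\<^sup>+x. liminf (\<lambda>n. ennreal (norm (Q (Complex x (y + e n)) * H (Complex x y)) powr p)) \<partial>lborel)"
    proof (intro nn_integral_cong)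
      fix x
      have "(\<lambda>n. Complex x (y + e n)) \<longlonglongrightarrow> Complex x (y + 0)"
        by (intro tendsto_intros tendsto_Complex e)
      then have "(\<lambda>n. Q (Complex x (y + e n))) \<longlonglongrightarrow> Q (Complex x y)"
        using isCont_tendsto_compose[OF Q_cont[of "Complex x y"]] y by (simp add: upper_halfplane_def)
      then have "(\<lambda>n. ennreal (norm (Q (Complex x (y + e n)) * H (Complex x y)) powr p)) \<longlonglongrightarrow> ennreal (norm (Q (Complex x y) * H (Complex x y)) powr p)"
        using p by (intro tendsto_ennrealI tendsto_powr' tendsto_norm tendsto_mult tendsto_const) auto
      from lim_imp_Liminf[OF sequentially_bot this]
      show "ennreal (norm (Q (Complex x y) * H (Complex x y)) powr p) = liminf (\<lambda>n. ennreal (norm (Q (Complex x (y + e n)) * H (Complex x y)) powr p))"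
        by (rule sym)
    qed
    also have "\<dots> \<le> liminf (\<lambda>n. \<integral>\<^sup>+x. ennreal (norm (Q (Complex x (y + e n)) * H (Complex x y)) powr p) \<partial>lborel)"
      by (intro nn_integral_liminf) measurable
    \<comment> \<open>\<open>e n \<le> 1\<close> replaces \<open>1 + e n\<close> by 2, which makes
      the bound uniform in \<open>n\<close> as well as in \<open>y\<close>.\<close>
    also have "\<dots> \<le> ennreal ((2 powr \<alpha>) powr p * C)"
    proof (intro Liminf_le sequentially_bot always_eventually allI)
      fix n
      have "e n \<le> 1"
        by (simp add: e_def field_simps)
      then have "((1 + e n) powr \<alpha>) powr p \<le> (2 powr \<alpha>) powr p"
        using \<alpha> p e(1)[of n] by (intro powr_mono2) auto
      then have "ennreal (((1 + e n) powr \<alpha>) powr p * C) \<le> ennreal ((2 powr \<alpha>) powr p * C)"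
        using C(1) by (intro ennreal_leI mult_right_mono) auto
      then show "(\<integral>\<^sup>+x. ennreal (norm (Q (Complex x (y + e n)) * H (Complex x y)) powr p) \<partial>lborel) \<le> ennreal ((2 powr \<alpha>) powr p * C)"
        using translate[OF e(1) y] order_trans by blast
    qed
    finally show "(\<integral>\<^sup>+x. ennreal (norm (Q (Complex x y) * H (Complex x y)) powr p) \<partial>lborel) \<le> ennreal ((2 powr \<alpha>) powr p * C)" .
  qed
  moreover have "has_boundary_values (\<lambda>z. Q z * H z) (\<lambda>x. quotient_power M \<alpha> x * h x)"
    unfolding Q_def by (intro has_boundary_values_mult H(2) exp_quotient_log_branch_boundary_values)
  ultimately show ?thesis
    using Lp by (auto simp: Hp_plus_def)
qed

end

subsection \<open>Toeplitz kernels\<close>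

lemma zero_in_Hp_plus: "(\<lambda>x. 0) \<in> Hp_plus p"
proof -
  have "(\<lambda>_. 0) \<in> hardy_space p" "has_boundary_values (\<lambda>_. 0) (\<lambda>_. 0)"
    by (auto simp: hardy_space_def has_boundary_values_def)
  then show ?thesis
    by (auto simp: Hp_plus_def Lp_def)
qed

text \<open>Projecting to 0 means that the product itself lies in \<open>Hp_minus p\<close>; its
  membership in \<open>Lp p\<close> is already part of the domain.\<close>

lemma toeplitz_kernel_iff:
  "\<phi> \<in> toeplitz_kernel p g \<longleftrightarrow> \<phi> \<in> toeplitz_domain p g \<and> (\<lambda>x. g x * \<phi> x) \<in> Hp_minus p"
  by (auto simp: toeplitz_kernel_def toeplitz_def toeplitz_domain_def P_plus_def zero_in_Hp_plus)

lemma r_fun_measurable: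
  assumes "log_branch c L"
  shows "r_fun L a \<in> borel_measurable lebesgue"
proof -
  have "continuous_on (- {c}) (r_fun L a)"
    unfolding r_fun_def by (intro continuous_intros log_branch_cayley(1)[OF assms])
  then have "r_fun L a \<in> borel_measurable borel"
    by (intro borel_measurable_continuous_countable_exceptions[of "{c}"]) auto
  then show ?thesis
    by (intro measurable_completion) simp
qed

theorem theorem8p1:
  fixes p c \<alpha> :: real and f g :: "real \<Rightarrow> complex" and L M :: "complex \<Rightarrow> complex"
  assumes "1 < p"
    and "f \<in> symbol_class p"
    and "0 < \<alpha>" and "\<alpha> < 1"
    and "log_branch c L"
    and "quotient_log_branch c M"
    and "g = (\<lambda>\<xi>. f \<xi> * r_fun L (complex_of_real \<alpha>) \<xi>)"
  shows "toeplitz_domain p g = toeplitz_domain p f \<and>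
         toeplitz_kernel p g =
           times_set (quotient_power M (complex_of_real \<alpha>)) (toeplitz_kernel p f) \<inter> toeplitz_domain p g"
proof -
  define r where "r = r_fun L (complex_of_real \<alpha>)"
  define Q where "Q = quotient_power M (complex_of_real \<alpha>)"
  note L = \<open>log_branch c L\<close> and M = \<open>quotient_log_branch c M\<close>
  have g: "g x = f x * r x" for x
    using assms(7) by (simp add: r_def)
  have [measurable]: "f \<in> borel_measurable lebesgue"
    using assms(2) by (simp add: symbol_class_def)
  have [measurable]: "r \<in> borel_measurable lebesgue" "Q \<in> borel_measurable lebesgue"
    unfolding r_def Q_def by (rule r_fun_measurable[OF L] quotient_power_measurable[OF M])+
  have [measurable]: "g \<in> borel_measurable lebesgue"
    unfolding g[abs_def] by measurable
  have norm_r: "norm (r x) = 1" if "x \<noteq> c" for x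
    unfolding r_def by (rule norm_r_fun[OF L that])
  have Q_nz: "Q x \<noteq> 0" for x
    by (simp add: Q_def quotient_power_def)
  obtain \<kappa> where \<kappa>: "norm \<kappa> = 1" "\<And>x. x \<noteq> c \<Longrightarrow> r x * Q x = \<kappa> * cnj (Q x)"
    unfolding r_def Q_def by (rule r_fun_mult_quotient_power[OF L M]) blast
  have \<kappa>_cnj: "\<kappa> * cnj \<kappa> = 1"
    using \<kappa>(1) by (simp add: complex_norm_square[symmetric])
  have \<kappa>_nz: "\<kappa> \<noteq> 0" using \<kappa>(1) by auto
  have measurable_Hp: "\<phi> \<in> borel_measurable lebesgue" if "\<phi> \<in> Hp_plus p" for \<phi>
    using that by (simp add: Hp_plus_def Lp_def)
  have domain: "toeplitz_domain p g = toeplitz_domain p f"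
  proof -
    have "(\<lambda>x. g x * \<phi> x) \<in> Lp p \<longleftrightarrow> (\<lambda>x. f x * \<phi> x) \<in> Lp p" if "\<phi> \<in> Hp_plus p" for \<phi>
    proof -
      have [measurable]: "\<phi> \<in> borel_measurable lebesgue"
        using that by (rule measurable_Hp)
      have AE: "AE x in lebesgue. norm (g x * \<phi> x) = norm (f x * \<phi> x)"
        using AE_lebesgue_neq[of c] by eventually_elim (simp add: g norm_mult norm_r)
      show ?thesis
      proof
        assume "(\<lambda>x. g x * \<phi> x) \<in> Lp p"
        then show "(\<lambda>x. f x * \<phi> x) \<in> Lp p"
          by (rule Lp_cong_AE) (use AE in auto)
      next
        assume "(\<lambda>x. f x * \<phi> x) \<in> Lp p"
        then show "(\<lambda>x. g x * \<phi> x) \<in> Lp p"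
          by (rule Lp_cong_AE) (use AE in auto)
      qed
    qed
    then show ?thesis
      unfolding toeplitz_domain_def by blast
  qed
  have "toeplitz_kernel p g = times_set Q (toeplitz_kernel p f) \<inter> toeplitz_domain p g"
  proof (intro equalityI subsetI)
    fix \<phi> assume "\<phi> \<in> toeplitz_kernel p g"
    then have dom: "\<phi> \<in> toeplitz_domain p g" and "(\<lambda>x. cnj (g x * \<phi> x)) \<in> Hp_plus p"
      by (auto simp: toeplitz_kernel_iff Hp_minus_iff)
    have \<phi>: "\<phi> \<in> Hp_plus p" using dom by (simp add: toeplitz_domain_def)
    note [measurable] = measurable_Hp[OF \<phi>]
    define \<psi> where "\<psi> x = \<phi> x / Q x" for x
    have \<psi>: "\<psi> \<in> Hp_plus p"
      unfolding \<psi>_def Q_def using assms by (intro Hp_plus_divide_quotient_power[OF M \<phi>]) auto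
    note [measurable] = measurable_Hp[OF \<psi>]
    \<comment> \<open>Conjugating \<open>g \<phi> = f \<psi> \<kappa> cnj Q\<close> turns
      \<open>cnj Q\<close> into \<open>Q\<close>, so the division is again by the analytic factor;
      multiplying by \<open>\<kappa>\<close> cancels \<open>cnj \<kappa>\<close>.\<close>
    have "(\<lambda>x. \<kappa> * (cnj (g x * \<phi> x) / Q x)) \<in> Hp_plus p"
      unfolding Q_def using assms
      by (intro Hp_plus_cmult Hp_plus_divide_quotient_power[OF M \<open>(\<lambda>x. cnj (g x * \<phi> x)) \<in> Hp_plus p\<close>]) auto
    moreover have "(\<lambda>x. cnj (f x * \<psi> x)) \<in> borel_measurable lebesgue"
      by (intro cnj_borel_measurable) measurable
    moreover have "AE x in lebesgue. cnj (f x * \<psi> x) = \<kappa> * (cnj (g x * \<phi> x) / Q x)"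
      using AE_lebesgue_neq[of c]
    proof eventually_elim
      case (elim x)
      have "g x * \<phi> x = f x * \<psi> x * (r x * Q x)"
        using Q_nz[of x] by (simp add: g \<psi>_def)
      also have "\<dots> = f x * \<psi> x * \<kappa> * cnj (Q x)"
        by (simp add: \<kappa>(2)[OF elim])
      finally have "\<kappa> * (cnj (g x * \<phi> x) / Q x) = (\<kappa> * cnj \<kappa>) * cnj (f x * \<psi> x)"
        using Q_nz[of x] by simp
      then show ?case by (simp add: \<kappa>_cnj)
    qed
    ultimately have minus: "(\<lambda>x. cnj (f x * \<psi> x)) \<in> Hp_plus p"
      by (rule Hp_plus_cong_AE)
    \<comment> \<open>The equality of domains concerns \<open>\<phi>\<close>, not
      \<open>\<psi>\<close>; that \<open>\<psi>\<close> lies in the domain of \<open>f\<close> is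
      read off from the Hardy membership just proved.\<close>
    then have "(\<lambda>x. cnj (f x * \<psi> x)) \<in> Lp p"
      by (simp add: Hp_plus_def)
    from Lp_cnj[OF this] have "(\<lambda>x. f x * \<psi> x) \<in> Lp p" by simp
    then have "\<psi> \<in> toeplitz_kernel p f"
      using \<psi> minus by (simp add: toeplitz_kernel_iff Hp_minus_iff toeplitz_domain_def)
    moreover have "AE x in lebesgue. \<phi> x = Q x * \<psi> x"
      using Q_nz by (simp add: \<psi>_def)
    moreover have "\<phi> \<in> borel_measurable lebesgue" by measurable
    ultimately show "\<phi> \<in> times_set Q (toeplitz_kernel p f) \<inter> toeplitz_domain p g"
      using dom unfolding times_set_def by blast
  next
    fix \<phi> assume "\<phi> \<in> times_set Q (toeplitz_kernel p f) \<inter> toeplitz_domain p g"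
    then obtain \<psi> where dom: "\<phi> \<in> toeplitz_domain p g" and \<psi>: "\<psi> \<in> toeplitz_kernel p f"
      and AE: "AE x in lebesgue. \<phi> x = Q x * \<psi> x" and [measurable]: "\<phi> \<in> borel_measurable lebesgue"
      unfolding times_set_def by blast
    define h where "h x = cnj (f x * \<psi> x)" for x
    have h: "h \<in> Hp_plus p"
      using \<psi> unfolding h_def by (simp add: toeplitz_kernel_iff Hp_minus_iff)
    note [measurable] = measurable_Hp[OF h]
    have eq: "AE x in lebesgue. cnj (g x * \<phi> x) = cnj \<kappa> * (Q x * h x)"
      using AE AE_lebesgue_neq[of c]
    proof eventually_elim
      case (elim x)
      have "g x * \<phi> x = f x * \<psi> x * (r x * Q x)"
        by (simp add: g elim)
      also have "\<dots> = f x * \<psi> x * \<kappa> * cnj (Q x)"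
        by (simp add: \<kappa>(2)[OF elim(2)])
      finally show ?case by (simp add: h_def)
    qed
    \<comment> \<open>The intersection with the domain of \<open>g\<close> enters here:
      \<open>Q h\<close> has the same modulus as \<open>g \<phi>\<close>.\<close>
    have "(\<lambda>x. Q x * h x) \<in> Lp p"
    proof (rule Lp_cong_AE)
      show "(\<lambda>x. cnj (g x * \<phi> x)) \<in> Lp p"
        using dom by (intro Lp_cnj) (simp add: toeplitz_domain_def)
      show "AE x in lebesgue. norm (Q x * h x) = norm (cnj (g x * \<phi> x))"
        using eq by eventually_elim (simp only: norm_mult[of "cnj \<kappa>"] complex_mod_cnj \<kappa>(1) mult_1)
    qed measurable
    then have "(\<lambda>x. Q x * h x) \<in> Hp_plus p"
      unfolding Q_def using assms h by (intro Hp_plus_mult_quotient_power[OF M]) auto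
    then have "(\<lambda>x. cnj \<kappa> * (Q x * h x)) \<in> Hp_plus p"
      using assms by (intro Hp_plus_cmult) auto
    moreover have "(\<lambda>x. cnj (g x * \<phi> x)) \<in> borel_measurable lebesgue"
      by (intro cnj_borel_measurable) measurable
    ultimately have "(\<lambda>x. cnj (g x * \<phi> x)) \<in> Hp_plus p"
      using eq by (rule Hp_plus_cong_AE)
    then show "\<phi> \<in> toeplitz_kernel p g"
      using dom by (simp add: toeplitz_kernel_iff Hp_minus_iff)
  qed
  then show ?thesis
    using domain by (simp add: Q_def)
qed

end
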